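(* Let $N\ge 1$, let $(\mathbf{A},\mathbf{B})$ be a pair of (possibly dependent) random real $N\times N$ matrices, and let $(\mathbf{A}_n,\mathbf{B}_n)_{n\ge1}$ be i.i.d. copies of $(\mathbf{A},\mathbf{B})$. Assume that $$\mathbb{E}\left[\log^+\left(\lambda_{\max}(\mathbf{A}\mathbf{A}^\top)\right)\right]<+\infty,\qquad \mathbb{E}\left[\log^+\left(\lambda_{\max}(\mathbf{B}\mathbf{B}^\top)\right)\right]<+\infty,$$ and $$\gamma:=\inf_{n\ge1}\frac1n\,\mathbb{E}\left[\log\left(\lambda_{\max}\left(\mathbf{A}_1\mathbf{A}_2\cdots\mathbf{A}_n\mathbf{A}_n^\top\cdots\mathbf{A}_2^\top\mathbf{A}_1^\top\right)\right)\right]<0.$$ Then there exists a unique (in distribution) solution $\mathbf{X}$ to $$\mathbf{X}\stackrel{d}{=}\mathbf{A}\mathbf{X}\mathbf{A}^\top+\mathbf{B},\qquad (\mathbf{A},\mathbf{B})\text{ and }\mathbf{X}\text{ independent}.$$ Moreover, this solution has the series representation $$\mathbf{X}\stackrel{d}{=}\sum_{n=1}^\infty \mathbf{A}_1\cdots\mathbf{A}_{n-1}\,\mathbf{B}_n\,\mathbf{A}_{n-1}^\top\cdots\mathbf{A}_1^\top,$$ where the series on the right-hand side converges almost surely. Finally, if $$\mathbf{X}_n=\mathbf{A}_n\mathbf{X}_{n-1}\mathbf{A}_n^\top+\mathbf{B}_n,\qquad n\ge1,$$ where $\mathbf{X}_0$ is a random real $N\times N$ matrix independent of $(\mathbf{A}_n,\mathbf{B}_n)_{n\ge1}$,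 then $\mathbf{X}_n$ converges in distribution to $\mathbf{X}$.
   Context: $\stackrel{d}{=}$ denotes equality in distribution. A solution of the fixed-point equation is a random real $N\times N$ matrix $\mathbf{X}$ (more precisely, its law) such that, when $\mathbf{X}$ is taken independent of $(\mathbf{A},\mathbf{B})$, the displayed equality in law holds; uniqueness refers to the law of $\mathbf{X}$. $\lambda_{\max}(\mathbf{a})$ is the largest eigenvalue of a symmetric matrix $\mathbf{a}$; $\log^+(a)=\max\{\log a,0\}$ for $a>0$ (and $\log^+0=0$, $\log 0=-\infty$). For $n=1$ the product $\mathbf{A}_1\cdots\mathbf{A}_{n-1}$ is the identity matrix. *)

theory Defs
  imports "HOL-Probability.Probability"
begin

definition eigenvalues :: "real^'n^'n \<Rightarrow> real set" where
  "eigenvalues a = {l. \<exists>v. v \<noteq> 0 \<and> a *v v = l *\<^sub>R v}"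

text \<open>Meaningful for symmetric \<open>a\<close>, whose set of real eigenvalues is finite and nonempty.\<close>

definition lambda_max :: "real^'n^'n \<Rightarrow> real" where
  "lambda_max a = Max (eigenvalues a)"

definition log_plus :: "real \<Rightarrow> real" where
  "log_plus x = (if x > 0 then max (ln x) 0 else 0)"

text \<open>Logarithm on \<open>[0, \<infinity>)\<close> with \<open>log 0 = -\<infinity>\<close>; the library's \<open>ln 0\<close> is \<open>0\<close>.\<close>

definition ext_log :: "real \<Rightarrow> ereal" where
  "ext_log x = (if x > 0 then ereal (ln x) else -\<infinity>)"

text \<open>
  \<open>E[f\<^sup>+] - E[f\<^sup>-]\<close> for an extended-real random variable: \<open>e2ennreal\<close> maps negative
  arguments to \<open>0\<close>. If only \<open>E[f\<^sup>-]\<close> is infinite the value is \<open>-\<infinity>\<close>; in the undefined case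
  where both parts are infinite it is \<open>\<infinity>\<close>.
\<close>

definition ext_expectation :: "'a measure \<Rightarrow> ('a \<Rightarrow> ereal) \<Rightarrow> ereal" where
  "ext_expectation M f =
     enn2ereal (\<integral>\<^sup>+\<omega>. e2ennreal (f \<omega>) \<partial>M) - enn2ereal (\<integral>\<^sup>+\<omega>. e2ennreal (- f \<omega>) \<partial>M)"

text \<open>\<open>left_prod a n\<close> is \<open>a 1 ** \<dots> ** a n\<close>, and \<open>right_prod a n\<close> is
  \<open>transpose (a n) ** \<dots> ** transpose (a 1)\<close>; \<open>a 0\<close> is not used.\<close>

primrec left_prod :: "(nat \<Rightarrow> real^'n^'n) \<Rightarrow> nat \<Rightarrow> real^'n^'n" where
  "left_prod a 0 = mat 1"
| "left_prod a (Suc n) = left_prod a n ** a (Suc n)"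

primrec right_prod :: "(nat \<Rightarrow> real^'n^'n) \<Rightarrow> nat \<Rightarrow> real^'n^'n" where
  "right_prod a 0 = mat 1"
| "right_prod a (Suc n) = transpose (a (Suc n)) ** right_prod a n"

definition lyapunov_gamma :: "'a measure \<Rightarrow> (nat \<Rightarrow> 'a \<Rightarrow> real^'n^'n) \<Rightarrow> ereal" where
  "lyapunov_gamma M A =
     (INF n\<in>{1..}. ereal (1 / real n) *
        ext_expectation M (\<lambda>\<omega>. ext_log (lambda_max
          (left_prod (\<lambda>k. A k \<omega>) n ** right_prod (\<lambda>k. A k \<omega>) n))))"

definition series_term :: "(nat \<Rightarrow> real^'n^'n) \<Rightarrow> (nat \<Rightarrow> real^'n^'n) \<Rightarrow> nat \<Rightarrow> real^'n^'n" where
  "series_term a b n = left_prod a (n - 1) ** b n ** right_prod a (n - 1)"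

text \<open>
  Independence of two random variables with values in different types; the library's
  \<open>indep_var\<close> requires a common value type.
\<close>

definition indep_rvs ::
  "'a measure \<Rightarrow> 'b measure \<Rightarrow> ('a \<Rightarrow> 'b) \<Rightarrow> 'c measure \<Rightarrow> ('a \<Rightarrow> 'c) \<Rightarrow> bool" where
  "indep_rvs M S X T Y \<longleftrightarrow> X \<in> measurable M S \<and> Y \<in> measurable M T \<and>
     prob_space.indep_set M {X -` U \<inter> space M | U. U \<in> sets S}
                            {Y -` V \<inter> space M | V. V \<in> sets T}"

text \<open>
  \<open>\<mu>\<close> is the law of a solution of \<open>X = A X A\<^sup>T + B\<close> in distribution, with \<open>(A, B)\<close> of law \<open>\<nu>\<close>
  and \<open>X\<close> independent of \<open>(A, B)\<close>. Independence means that the joint law is \<open>\<nu> \<Otimes>\<^sub>M \<mu>\<close>.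
  The lemma below says that this agrees with the formulation by random variables on an
  arbitrary probability space.
\<close>

definition solution_law :: "((real^'n^'n) \<times> (real^'n^'n)) measure \<Rightarrow> (real^'n^'n) measure \<Rightarrow> bool" where
  "solution_law \<nu> \<mu> \<longleftrightarrow> prob_space \<mu> \<and> sets \<mu> = sets borel \<and>
     \<mu> = distr (\<nu> \<Otimes>\<^sub>M \<mu>) borel (\<lambda>((a, b), x). a ** x ** transpose a + b)"

lemma continuous_matrix_mult:
  fixes f g :: "'a::topological_space \<Rightarrow> real^'n^'n"
  assumes "continuous_on S f" "continuous_on S g"
  shows "continuous_on S (\<lambda>x. f x ** g x)"
  unfolding matrix_matrix_mult_def using assms by (intro continuous_intros) auto

lemma continuous_transpose:
  fixes f :: "'a::topological_space \<Rightarrow> real^'n^'n"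
  assumes "continuous_on S f"
  shows "continuous_on S (\<lambda>x. transpose (f x))"
  unfolding transpose_def using assms by (intro continuous_intros) auto

lemma (in prob_space) solution_law_iff:
  fixes A B X :: "'a \<Rightarrow> real^'n^'n"
  assumes "indep_rvs M borel (\<lambda>\<omega>. (A \<omega>, B \<omega>)) borel X"
  shows "solution_law (distr M borel (\<lambda>\<omega>. (A \<omega>, B \<omega>))) (distr M borel X) \<longleftrightarrow>
         distr M borel X = distr M borel (\<lambda>\<omega>. A \<omega> ** X \<omega> ** transpose (A \<omega>) + B \<omega>)"
proof -
  let ?g = "\<lambda>((a :: real^'n^'n, b :: real^'n^'n), x :: real^'n^'n). a ** x ** transpose a + b"
  have AB [measurable]: "(\<lambda>\<omega>. (A \<omega>, B \<omega>)) \<in> borel_measurable M"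
    and X [measurable]: "X \<in> borel_measurable M"
    and indep: "indep_set {(\<lambda>\<omega>. (A \<omega>, B \<omega>)) -` U \<inter> space M | U. U \<in> sets borel}
      {X -` V \<inter> space M | V. V \<in> sets borel}"
    using assms by (simp_all add: indep_rvs_def)
  interpret D: prob_space "distr M borel (\<lambda>\<omega>. (A \<omega>, B \<omega>))" by (rule prob_space_distr) simp
  interpret E: prob_space "distr M borel X" by (rule prob_space_distr) simp
  have joint: "distr M borel (\<lambda>\<omega>. (A \<omega>, B \<omega>)) \<Otimes>\<^sub>M distr M borel X =
      distr M (borel \<Otimes>\<^sub>M borel) (\<lambda>\<omega>. ((A \<omega>, B \<omega>), X \<omega>))"
  proof (rule pair_measure_eqI)
    fix U :: "((real^'n^'n) \<times> (real^'n^'n)) set" and V :: "(real^'n^'n) set"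
    assume "U \<in> sets (distr M borel (\<lambda>\<omega>. (A \<omega>, B \<omega>)))" "V \<in> sets (distr M borel X)"
    then have [measurable]: "U \<in> sets borel" "V \<in> sets borel" by simp_all
    let ?U = "(\<lambda>\<omega>. (A \<omega>, B \<omega>)) -` U \<inter> space M" and ?V = "X -` V \<inter> space M"
    have "prob (?U \<inter> ?V) = prob ?U * prob ?V"
      by (rule indep_setD[OF indep]) auto
    moreover have "(\<lambda>\<omega>. ((A \<omega>, B \<omega>), X \<omega>)) -` (U \<times> V) \<inter> space M = ?U \<inter> ?V" by auto
    ultimately show "emeasure (distr M borel (\<lambda>\<omega>. (A \<omega>, B \<omega>))) U * emeasure (distr M borel X) V =
        emeasure (distr M (borel \<Otimes>\<^sub>M borel) (\<lambda>\<omega>. ((A \<omega>, B \<omega>), X \<omega>))) (U \<times> V)"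
      by (simp add: emeasure_distr emeasure_eq_measure ennreal_mult)
  qed (auto intro: D.sigma_finite_measure_axioms E.sigma_finite_measure_axioms)
  have "continuous_on UNIV ?g"
    unfolding case_prod_beta
    by (intro continuous_matrix_mult continuous_transpose continuous_intros)
  then have g: "?g \<in> borel_measurable (borel \<Otimes>\<^sub>M borel)"
    unfolding borel_prod by (rule borel_measurable_continuous_onI)
  have "distr (distr M borel (\<lambda>\<omega>. (A \<omega>, B \<omega>)) \<Otimes>\<^sub>M distr M borel X) borel ?g =
      distr M borel (\<lambda>\<omega>. A \<omega> ** X \<omega> ** transpose (A \<omega>) + B \<omega>)"
    unfolding joint by (subst distr_distr[OF g]) (auto simp: comp_def)
  then show ?thesis
    unfolding solution_law_def by (auto intro: prob_space_distr)
qed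

text \<open>Weak convergence of laws; the library's \<open>weak_conv_m\<close> covers only laws on the reals.\<close>

definition weak_conv_laws :: "(nat \<Rightarrow> 'b::real_normed_vector measure) \<Rightarrow> 'b measure \<Rightarrow> bool" where
  "weak_conv_laws \<mu>s \<mu> \<longleftrightarrow>
     (\<forall>f :: 'b \<Rightarrow> real. continuous_on UNIV f \<and> bounded (range f) \<longrightarrow>
        (\<lambda>n. \<integral>x. f x \<partial>\<mu>s n) \<longlonglongrightarrow> (\<integral>x. f x \<partial>\<mu>))"

end

theory Submission
  imports Defs
begin

text \<open>
  Write \<open>\<Pi>\<^sub>n = A\<^sub>1 \<dots> A\<^sub>n\<close> and let \<open>\<parallel>\<cdot>\<parallel>\<close> be the spectral norm, so that
  \<open>\<lambda>\<^sub>m\<^sub>a\<^sub>x(a a\<^sup>T) = \<parallel>a\<parallel>\<^sup>2\<close> (\<open>lambda_max_gram\<close>). The \<open>n\<close>-th term of the series is at most a constant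
  times \<open>\<parallel>\<Pi>\<^sub>n\<^sub>-\<^sub>1\<parallel>\<^sup>2 \<parallel>B\<^sub>n\<parallel>\<close>, so the series converges once \<open>\<parallel>\<Pi>\<^sub>n\<parallel>\<^sup>2\<close> decays exponentially while
  \<open>\<parallel>B\<^sub>n\<parallel>\<close> grows more slowly than any exponential.

  For the decay, note that \<open>\<gamma> < 0\<close> gives a block length \<open>m\<close> with
  \<open>E log \<parallel>\<Pi>\<^sub>m\<parallel>\<^sup>2 < 0\<close>; truncating the logarithm from below keeps the expectation negative and makes
  it finite (\<open>truncated_log_integral_neg\<close>). By submultiplicativity \<open>log \<parallel>\<Pi>\<^sub>k\<^sub>m\<parallel>\<^sup>2\<close> is at most the sum of
  the truncated logarithms of \<open>k\<close> independent blocks. The partial sums of i.i.d. variables with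
  negative mean are almost surely bounded above (\<open>AE_sums_bounded_above\<close>); applied with half
  of the drift held back, this gives a linear rate. The proof is Garsia's argument for the
  maximal ergodic inequality. The same bound, applied to \<open>V - E V - \<epsilon>\<close> and to \<open>E V - \<epsilon> - V\<close> for
  \<open>V = log\<^sup>+ \<parallel>A\<parallel>\<^sup>2\<close> and \<open>V = log\<^sup>+ \<parallel>B\<parallel>\<^sup>2\<close>, shows that single factors grow subexponentially
  (\<open>AE_sublinear_growth\<close>), which controls incomplete blocks and the matrices \<open>B\<^sub>n\<close>.

  Iterating \<open>x \<mapsto> A x A\<^sup>T + B\<close> backwards, with the newest map applied innermost, gives the partial
  sum of the series plus \<open>\<Pi>\<^sub>n x \<Pi>\<^sub>n\<^sup>T\<close>, hence converges almost surely to the sum of the series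
  whatever \<open>x\<close> is (\<open>AE_backward_converges\<close>). The forward iterates \<open>X\<^sub>n\<close> have, for each \<open>n\<close>, the law of
  the backward ones, because both are described by the \<open>n\<close>-th power of one transition operator
  (\<open>law_forward_eq_backward\<close>); so they converge in distribution. A solution of the fixed-point
  equation is an initial law that the iteration leaves unchanged, so it equals the limit: this is
  uniqueness. The series itself is a solution by splitting off its first term.
\<close>

section \<open>The spectral norm\<close>

(* Eigenvector equations for a a^T are clearest with transpose a *v v kept as it is, rather than
   rewritten to v v* a. *)
declare transpose_matrix_vector [simp del]

abbreviation opnorm :: "real^'n^'n \<Rightarrow> real" where
  "opnorm a \<equiv> onorm ((*v) a)"

lemma opnorm_bound: "norm (a *v v) \<le> opnorm a * norm (v :: real^'n)"
  for a :: "real^'n^'n"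
  by (rule onorm[OF matrix_vector_mul_bounded_linear])

lemma opnorm_nonneg: "0 \<le> opnorm (a :: real^'n^'n)"
  by (rule onorm_pos_le[OF matrix_vector_mul_bounded_linear])

lemma inner_gram: "(a ** transpose a *v v) \<bullet> w = (transpose a *v v) \<bullet> (transpose a *v w)"
  for a :: "real^'n^'n"
  by (metis dot_lmul_matrix inner_commute matrix_vector_mul_assoc transpose_matrix_vector)

text \<open>
  With \<open>w = a\<^sup>T v\<close>, \<open>\<bar>w\<bar>\<^sup>2 = (a w) \<bullet> v \<le> \<parallel>a\<parallel> \<bar>w\<bar> \<bar>v\<bar>\<close>; divide by \<open>\<bar>w\<bar>\<close>.
\<close>
lemma opnorm_transpose_le: "opnorm (transpose a) \<le> opnorm (a :: real^'n^'n)"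
proof (rule onorm_le)
  fix v :: "real^'n"
  let ?w = "transpose a *v v"
  have "norm ?w * norm ?w = (a ** transpose a *v v) \<bullet> v"
    by (simp add: inner_gram power2_norm_eq_inner[symmetric] power2_eq_square)
  also have "\<dots> \<le> norm (a *v ?w) * norm v"
    by (simp add: matrix_vector_mul_assoc norm_cauchy_schwarz)
  also have "\<dots> \<le> (opnorm a * norm ?w) * norm v"
    by (intro mult_right_mono opnorm_bound) simp
  finally have "norm ?w * norm ?w \<le> (opnorm a * norm v) * norm ?w"
    by (simp add: mult_ac)
  then show "norm ?w \<le> opnorm a * norm v"
    using opnorm_nonneg[of a] by (cases "norm ?w = 0") (auto simp: mult_le_cancel_right)
qed

lemma opnorm_transpose: "opnorm (transpose a) = opnorm (a :: real^'n^'n)"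
  using opnorm_transpose_le[of a] opnorm_transpose_le[of "transpose a"] by simp

text \<open>
  Eigenvectors of a symmetric matrix for distinct eigenvalues are orthogonal, hence independent.
  Finiteness is what makes \<open>Max\<close> in \<open>lambda_max\<close> an actual maximum.
\<close>
lemma finite_eigenvalues_gram: "finite (eigenvalues (a ** transpose a))"
  for a :: "real^'n^'n"
proof -
  let ?G = "a ** transpose a"
  let ?E = "eigenvalues ?G"
  have "\<forall>l\<in>?E. \<exists>v. v \<noteq> 0 \<and> ?G *v v = l *\<^sub>R v"
    by (auto simp: eigenvalues_def)
  then obtain e where e: "\<And>l. l \<in> ?E \<Longrightarrow> e l \<noteq> 0 \<and> ?G *v e l = l *\<^sub>R e l"
    by metis
  have orth: "e l \<bullet> e k = 0" if "l \<in> ?E" "k \<in> ?E" "l \<noteq> k" for l k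
  proof -
    have "(?G *v e l) \<bullet> e k = (?G *v e k) \<bullet> e l"
      unfolding inner_gram by (rule inner_commute)
    then have "l * (e l \<bullet> e k) = k * (e l \<bullet> e k)"
      using e that by (simp add: inner_commute)
    then show ?thesis using that by simp
  qed
  then have "inj_on e ?E"
    using e by (metis inj_onI inner_eq_zero_iff)
  moreover have "finite (e ` ?E)"
  proof (rule finiteI_independent, rule pairwise_orthogonal_independent)
    show "pairwise orthogonal (e ` ?E)"
      by (auto simp: pairwise_def orthogonal_def intro!: orth)
    show "0 \<notin> e ` ?E" using e by force
  qed
  ultimately show ?thesis by (rule finite_imageD[rotated])
qed

text \<open>
  Let \<open>v\<close> be a unit vector at which \<open>\<bar>a\<^sup>T v\<bar>\<close> is maximal, so that this maximum is \<open>\<parallel>a\<parallel>\<close>. Expanding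
  \<open>\<bar>a a\<^sup>T v - \<parallel>a\<parallel>\<^sup>2 v\<bar>\<^sup>2\<close> gives at most \<open>0\<close>, so \<open>v\<close> is an eigenvector for \<open>\<parallel>a\<parallel>\<^sup>2\<close>. No eigenvalue is
  larger, since \<open>l \<bar>w\<bar>\<^sup>2 = \<bar>a\<^sup>T w\<bar>\<^sup>2\<close> for an eigenvector \<open>w\<close>.
\<close>
lemma lambda_max_gram: "lambda_max (a ** transpose a) = (opnorm a)\<^sup>2"
  for a :: "real^'n^'n"
proof -
  let ?t = "transpose a" and ?N = "opnorm a"
  have "sphere (0 :: real^'n) 1 \<noteq> {}"
    by (metis dist_0_norm empty_iff mem_sphere norm_axis_1)
  moreover have "continuous_on (sphere 0 1) (\<lambda>w. norm (?t *v w))"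
    by (intro continuous_intros linear_continuous_on matrix_vector_mul_bounded_linear)
  ultimately have "\<exists>v\<in>sphere 0 1. \<forall>w\<in>sphere 0 1. norm (?t *v w) \<le> norm (?t *v v)"
    by (intro continuous_attains_sup) auto
  then obtain v where v: "norm v = 1" and max: "\<And>w. norm w = 1 \<Longrightarrow> norm (?t *v w) \<le> norm (?t *v v)"
    by auto
  have "opnorm ?t \<le> norm (?t *v v)"
  proof (rule onorm_le)
    fix w :: "real^'n"
    show "norm (?t *v w) \<le> norm (?t *v v) * norm w"
    proof (cases "w = 0")
      case False
      then have "norm (?t *v (inverse (norm w) *\<^sub>R w)) \<le> norm (?t *v v)"
        by (intro max) simp
      then show ?thesis using False
        by (simp add: matrix_vector_mult_scaleR field_simps)
    qed simp
  qed
  moreover have "norm (?t *v v) \<le> opnorm ?t"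
    using opnorm_bound[of ?t v] v by simp
  ultimately have N: "norm (?t *v v) = ?N" by (simp add: opnorm_transpose)
  let ?g = "a ** ?t *v v"
  have "(norm (?g - ?N\<^sup>2 *\<^sub>R v))\<^sup>2 = (norm ?g)\<^sup>2 - 2 * ?N\<^sup>2 * (?g \<bullet> v) + ?N^4 * (norm v)\<^sup>2"
    unfolding power2_norm_eq_inner
    by (simp add: inner_diff inner_commute algebra_simps flip: power_add)
  also have "?g \<bullet> v = ?N\<^sup>2"
    by (simp add: inner_gram power2_norm_eq_inner[symmetric] N)
  also have "(norm ?g)\<^sup>2 \<le> (?N * ?N)\<^sup>2"
    using opnorm_bound[of a "?t *v v"] by (intro power_mono) (simp_all add: N matrix_vector_mul_assoc)
  also have "(?N * ?N)\<^sup>2 - 2 * ?N\<^sup>2 * ?N\<^sup>2 + ?N^4 * (norm v)\<^sup>2 = 0"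
    by (simp add: v power2_eq_square power4_eq_xxxx)
  finally have "?g = ?N\<^sup>2 *\<^sub>R v" by simp
  then have mem: "?N\<^sup>2 \<in> eigenvalues (a ** ?t)"
    using v unfolding eigenvalues_def by (auto intro!: exI[of _ v])
  have "l \<le> ?N\<^sup>2" if l: "l \<in> eigenvalues (a ** ?t)" for l
  proof -
    obtain w where w: "w \<noteq> 0" "a ** ?t *v w = l *\<^sub>R w"
      using l by (auto simp: eigenvalues_def)
    have "l * (norm w)\<^sup>2 = (a ** ?t *v w) \<bullet> w"
      by (simp add: w power2_norm_eq_inner)
    also have "\<dots> = (norm (?t *v w))\<^sup>2"
      by (simp add: inner_gram power2_norm_eq_inner)
    also have "\<dots> \<le> (opnorm ?t * norm w)\<^sup>2"
      by (intro power_mono opnorm_bound) simp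
    finally show ?thesis using w by (simp add: opnorm_transpose power_mult_distrib)
  qed
  then show ?thesis unfolding lambda_max_def
    by (intro Max_eqI finite_eigenvalues_gram mem)
qed

lemma opnorm_mult: "opnorm (a ** b) \<le> opnorm a * opnorm b"
  for a b :: "real^'n^'n"
proof -
  have "(*v) (a ** b) = (*v) a \<circ> (*v) b"
    by (auto simp: matrix_vector_mul_assoc)
  then show ?thesis
    using onorm_compose[OF matrix_vector_mul_bounded_linear[of a] matrix_vector_mul_bounded_linear[of b]]
    by simp
qed

lemma opnorm_one: "opnorm (mat 1 :: real^'n^'n) \<le> 1"
  by (rule onorm_le) simp

text \<open>
  The spectral norm and the Euclidean norm of the type are equivalent, in this and the next lemma
  with crude constants that are enough for convergence and continuity.
\<close>
lemma opnorm_le_norm: "opnorm a \<le> (real CARD('n))\<^sup>2 * norm a"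
  for a :: "real^'n^'n"
proof -
  have "\<bar>a $ i $ j\<bar> \<le> norm a" for i j
    using component_le_norm_cart[of "a $ i" j] Finite_Cartesian_Product.norm_nth_le[of a i] by linarith
  from onorm_le_matrix_component[OF this] show ?thesis
    by (simp add: power2_eq_square)
qed

lemma norm_le_opnorm: "norm a \<le> (real CARD('n))\<^sup>2 * opnorm a"
  for a :: "real^'n^'n"
proof -
  have "norm a \<le> (\<Sum>i\<in>UNIV. norm (a $ i))"
    by (simp add: norm_vec_def L2_set_le_sum)
  also have "\<dots> \<le> (\<Sum>i\<in>(UNIV::'n set). \<Sum>j\<in>(UNIV::'n set). opnorm a)"
    by (intro sum_mono order_trans[OF norm_le_l1_cart] matrix_component_le_onorm)
  finally show ?thesis by (simp add: power2_eq_square)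
qed

lemma norm_congruence_le:
  fixes a x :: "real^'n^'n"
  shows "norm (a ** x ** transpose a) \<le> (real CARD('n))^4 * (opnorm a)\<^sup>2 * norm x"
proof -
  let ?C = "(real CARD('n))\<^sup>2"
  have "opnorm (a ** x ** transpose a) \<le> opnorm (a ** x) * opnorm a"
    using opnorm_mult[of "a ** x" "transpose a"] by (simp add: opnorm_transpose)
  also have "\<dots> \<le> (opnorm a * opnorm x) * opnorm a"
    by (intro mult_right_mono opnorm_mult opnorm_nonneg)
  also have "\<dots> \<le> (opnorm a * (?C * norm x)) * opnorm a"
    by (intro mult_right_mono mult_left_mono opnorm_le_norm opnorm_nonneg)
  finally have "?C * opnorm (a ** x ** transpose a) \<le> ?C * ((opnorm a * (?C * norm x)) * opnorm a)"
    by (intro mult_left_mono) auto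
  with norm_le_opnorm[of "a ** x ** transpose a"]
  have "norm (a ** x ** transpose a) \<le> ?C * ((opnorm a * (?C * norm x)) * opnorm a)"
    by (rule order_trans)
  then show ?thesis
    by (simp add: power2_eq_square power4_eq_xxxx mult_ac)
qed

lemma opnorm_triangle: "opnorm (a + b) \<le> opnorm a + opnorm b"
  for a b :: "real^'n^'n"
  using onorm_triangle[OF matrix_vector_mul_bounded_linear[of a] matrix_vector_mul_bounded_linear[of b]]
  by (simp add: matrix_vector_mult_add_rdistrib[abs_def])

lemma continuous_opnorm: "continuous_on UNIV (opnorm :: real^'n^'n \<Rightarrow> real)"
proof (rule lipschitz_on_continuous_on)
  let ?C = "(real CARD('n))\<^sup>2"
  show "?C-lipschitz_on UNIV (opnorm :: real^'n^'n \<Rightarrow> real)"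
  proof (rule lipschitz_onI)
    fix a b :: "real^'n^'n"
    have "opnorm a - opnorm b \<le> ?C * dist a b" for a b :: "real^'n^'n"
      using opnorm_triangle[of "a - b" b] opnorm_le_norm[of "a - b"] by (simp add: dist_norm)
    from this[of a b] this[of b a] show "dist (opnorm a) (opnorm b) \<le> ?C * dist a b"
      by (simp add: dist_real_def dist_commute)
  qed simp
qed

lemma measurable_opnorm [measurable]: "(opnorm :: real^'n^'n \<Rightarrow> real) \<in> borel_measurable borel"
  by (rule borel_measurable_continuous_onI[OF continuous_opnorm])

section \<open>Sums with negative drift\<close>

text \<open>
  In terms of the Birkhoff sums \<open>S\<^sub>k = \<Sum>j<k. Y \<circ> T\<^sup>j\<close>, this is \<open>max {S\<^sub>0, \<dots>, S\<^sub>n}\<close>. The recursion is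
  the form in which Garsia's argument uses it: the maximum for \<open>w\<close> is expressed by the one for
  \<open>T w\<close>.
\<close>
primrec partial_max :: "('a \<Rightarrow> 'a) \<Rightarrow> ('a \<Rightarrow> real) \<Rightarrow> nat \<Rightarrow> 'a \<Rightarrow> real" where
  "partial_max T Y 0 w = 0"
| "partial_max T Y (Suc n) w = max 0 (Y w + partial_max T Y n (T w))"

lemma partial_max_nonneg: "0 \<le> partial_max T Y n w"
  by (cases n) auto

lemma partial_max_le_Suc: "partial_max T Y n w \<le> partial_max T Y (Suc n) w"
proof (induction n arbitrary: w)
  case (Suc n)
  from Suc.IH[of "T w"] show ?case by (auto simp: max_def)
qed simp

lemma partial_max_mono: "n \<le> k \<Longrightarrow> partial_max T Y n w \<le> partial_max T Y k w"
  by (rule lift_Suc_mono_le[of "\<lambda>n. partial_max T Y n w"]) (rule partial_max_le_Suc)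

lemma sum_le_partial_max: "(\<Sum>j<n. Y ((T ^^ j) w)) \<le> partial_max T Y n w"
proof (induction n arbitrary: w)
  case (Suc n)
  have "(\<Sum>j<Suc n. Y ((T ^^ j) w)) = Y w + (\<Sum>j<n. Y ((T ^^ j) (T w)))"
    by (subst sum.lessThan_Suc_shift) (simp add: funpow_swap1)
  then show ?case using Suc.IH[of "T w"] by simp
qed simp

definition unbounded_sums :: "'a measure \<Rightarrow> ('a \<Rightarrow> 'a) \<Rightarrow> ('a \<Rightarrow> real) \<Rightarrow> 'a set" where
  "unbounded_sums M T Y = {w \<in> space M. \<forall>c::nat. \<exists>n. real c < partial_max T Y n w}"

lemma partial_max_measurable [measurable]:
  assumes [measurable]: "T \<in> measurable M M" "Y \<in> borel_measurable M"
  shows "partial_max T Y n \<in> borel_measurable M"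
proof (induction n)
  case (Suc n)
  note [measurable] = Suc.IH
  show ?case by simp
qed simp

lemma unbounded_sums_sets [measurable]:
  assumes [measurable]: "T \<in> measurable M M" "Y \<in> borel_measurable M"
  shows "unbounded_sums M T Y \<in> sets M"
  unfolding unbounded_sums_def by measurable

text \<open>
  Passing from \<open>w\<close> to \<open>T w\<close> changes the maxima by the finite amount \<open>Y w\<close> only.
\<close>
lemma unbounded_sums_invariant:
  assumes w: "w \<in> space M" and T: "T \<in> measurable M M"
  shows "T w \<in> unbounded_sums M T Y \<longleftrightarrow> w \<in> unbounded_sums M T Y"
proof -
  have Tw: "T w \<in> space M" using w T by (rule measurable_space[rotated])
  obtain b :: nat where b: "\<bar>Y w\<bar> \<le> real b" using real_arch_simple by blast
  have "\<exists>n. real c < partial_max T Y n (T w)" if unb: "\<forall>c::nat. \<exists>n. real c < partial_max T Y n w" for c :: nat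
  proof -
    obtain n where n: "real (c + b) < partial_max T Y n w" using unb by blast
    then obtain k where "n = Suc k" by (cases n) auto
    with n b have "real c < partial_max T Y k (T w)" by (auto simp: max_def split: if_splits)
    then show ?thesis ..
  qed
  moreover have "\<exists>n. real c < partial_max T Y n w"
    if unb: "\<forall>c::nat. \<exists>n. real c < partial_max T Y n (T w)" for c :: nat
  proof -
    obtain n where n: "real (c + b) < partial_max T Y n (T w)" using unb by blast
    with b have "real c < partial_max T Y (Suc n) w" by auto
    then show ?thesis by blast
  qed
  ultimately show ?thesis using w Tw by (auto simp: unbounded_sums_def)
qed

text \<open>
  Garsia's argument, restricted to the invariant set \<open>D\<close> where the sums are unbounded. Let \<open>m\<^sub>n\<close> be
  the maximum of the first sums. Then \<open>m\<^sub>n\<^sub>+\<^sub>1 = m\<^sub>n \<circ> T + max Y (- m\<^sub>n \<circ> T)\<close>, and the integrals of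
  \<open>m\<^sub>n\<close> and \<open>m\<^sub>n \<circ> T\<close> over \<open>D\<close> agree, so \<open>m\<^sub>n \<le> m\<^sub>n\<^sub>+\<^sub>1\<close> makes the integral of
  \<open>max Y (- m\<^sub>n \<circ> T)\<close> over \<open>D\<close> nonnegative. On \<open>D\<close> this integrand becomes \<open>Y\<close> as \<open>n\<close> grows.
\<close>
lemma integral_unbounded_sums_nonneg:
  assumes T [measurable]: "T \<in> measurable M M" and inv: "distr M M T = M"
    and Y: "integrable M Y"
  shows "0 \<le> (\<integral>w. indicator (unbounded_sums M T Y) w * Y w \<partial>M)"
proof -
  let ?D = "unbounded_sums M T Y" and ?m = "partial_max T Y"
  have [measurable]: "Y \<in> borel_measurable M" using Y by simp
  have shift_integrable: "integrable M (\<lambda>w. f (T w))" if "integrable M f" for f :: "'a \<Rightarrow> real"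
    using that integrable_distr[OF T, of f] by (simp add: inv)
  have shift_integral: "(\<integral>w. f (T w) \<partial>M) = (\<integral>w. f w \<partial>M)"
    if [measurable]: "f \<in> borel_measurable M" for f :: "'a \<Rightarrow> real"
    using integral_distr[OF T that] by (simp add: inv)
  have m_int [simp]: "integrable M (?m n)" for n
  proof (induction n)
    case (Suc n)
    have "integrable M (\<lambda>w. Y w + ?m n (T w))"
      using Y shift_integrable[OF Suc.IH] by simp
    then have "integrable M (\<lambda>w. max 0 (Y w + ?m n (T w)))" by (intro integrable_max) simp_all
    then show ?case by simp
  qed simp
  have ind_int: "integrable M (\<lambda>w. indicator ?D w * f w)" if "integrable M f" for f :: "'a \<Rightarrow> real"
    using integrable_mult_indicator[OF _ that, of ?D] by simp
  let ?h = "\<lambda>n w. indicator ?D w * max (Y w) (- ?m n (T w))"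
  have h_nonneg: "0 \<le> (\<integral>w. ?h n w \<partial>M)" for n
  proof -
    have "(\<integral>w. indicator ?D w * ?m n w \<partial>M) \<le> (\<integral>w. indicator ?D w * ?m (Suc n) w \<partial>M)"
      by (intro integral_mono ind_int m_int mult_left_mono partial_max_le_Suc) simp
    also have "\<dots> = (\<integral>w. indicator ?D (T w) * ?m n (T w) + ?h n w \<partial>M)"
    proof (intro Bochner_Integration.integral_cong refl)
      fix w assume w: "w \<in> space M"
      have "indicator ?D (T w) = (indicator ?D w :: real)"
        using unbounded_sums_invariant[OF w T, of Y] by (simp add: indicator_def)
      then show "indicator ?D w * ?m (Suc n) w = indicator ?D (T w) * ?m n (T w) + ?h n w"
        by (auto simp: indicator_def max_def)
    qed
    also have "\<dots> = (\<integral>w. indicator ?D (T w) * ?m n (T w) \<partial>M) + (\<integral>w. ?h n w \<partial>M)"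
    proof (rule Bochner_Integration.integral_add)
      show "integrable M (\<lambda>w. indicator ?D (T w) * ?m n (T w))"
        by (rule shift_integrable) (intro ind_int m_int)
      show "integrable M (?h n)"
        by (intro ind_int integrable_max Y integrable_minus shift_integrable m_int)
    qed
    also have "(\<integral>w. indicator ?D (T w) * ?m n (T w) \<partial>M) = (\<integral>w. indicator ?D w * ?m n w \<partial>M)"
      by (rule shift_integral) simp
    finally show ?thesis by simp
  qed
  have "(\<lambda>n. \<integral>w. ?h n w \<partial>M) \<longlonglongrightarrow> (\<integral>w. indicator ?D w * Y w \<partial>M)"
  proof (rule integral_dominated_convergence[where w="\<lambda>w. \<bar>Y w\<bar>"])
    show "AE w in M. (\<lambda>n. ?h n w) \<longlonglongrightarrow> indicator ?D w * Y w"
    proof (rule AE_I2)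
      fix w assume w: "w \<in> space M"
      show "(\<lambda>n. ?h n w) \<longlonglongrightarrow> indicator ?D w * Y w"
      proof (cases "w \<in> ?D")
        case True
        obtain b :: nat where b: "\<bar>Y w\<bar> \<le> real b" using real_arch_simple by blast
        from True have "T w \<in> ?D" using unbounded_sums_invariant[OF w T] by simp
        then obtain n where n: "real b < ?m n (T w)" by (auto simp: unbounded_sums_def)
        have "?h k w = indicator ?D w * Y w" if "n \<le> k" for k
        proof -
          have "- ?m k (T w) \<le> Y w"
            using partial_max_mono[OF that, of T Y "T w"] n b by linarith
          then show ?thesis by simp
        qed
        then show ?thesis
          by (intro tendsto_eventually eventually_sequentiallyI[of n]) simp
      qed simp
    qed
    show "AE w in M. norm (?h n w) \<le> \<bar>Y w\<bar>" for n
    proof (rule AE_I2)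
      fix w
      show "norm (?h n w) \<le> \<bar>Y w\<bar>"
        using partial_max_nonneg[of T Y n "T w"] by (auto simp: indicator_def max_def)
    qed
  qed (use Y in simp_all)
  then show ?thesis
    using h_nonneg by (blast intro: LIMSEQ_le_const)
qed

context sequence_space
begin

lemma measurable_shift [measurable]: "(\<lambda>\<omega> i. \<omega> (i + m)) \<in> measurable S S"
  by (rule measurable_PiM_single') (auto simp: space_PiM PiE_iff)

lemma distr_shift: "distr S S (\<lambda>\<omega> i. \<omega> (i + m)) = S"
  using distr_PiM_reindex[of UNIV "\<lambda>_. M" "\<lambda>i. i + m" UNIV] prob_space_axioms
  by (simp add: M.prob_space_axioms inj_on_def restrict_UNIV)

text \<open>
  A one-sided law of large numbers. The hypothesis \<open>loc\<close> says that \<open>Y\<close> depends on the first \<open>m\<close>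
  coordinates only. The set \<open>D\<close> where the sums are unbounded is invariant under the shift by \<open>m\<close>,
  so it depends on the remaining coordinates and is independent of \<open>Y\<close>. Therefore the integral of
  \<open>Y\<close> over \<open>D\<close> is \<open>P(D) E Y\<close>; it is nonnegative by Garsia's argument, and \<open>E Y < 0\<close> forces
  \<open>P(D) = 0\<close>.
\<close>
lemma AE_sums_bounded_above:
  fixes Y :: "(nat \<Rightarrow> 'a) \<Rightarrow> real"
  assumes Y: "integrable S Y" and neg: "(\<integral>\<omega>. Y \<omega> \<partial>S) < 0"
    and loc: "\<And>\<omega> \<omega>'. Y (comb_seq m \<omega> \<omega>') = Y \<omega>"
  shows "AE \<omega> in S. \<exists>C. \<forall>n. (\<Sum>j<n. Y (\<lambda>i. \<omega> (i + j * m))) \<le> C"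
proof -
  let ?T = "\<lambda>\<omega> i. \<omega> (i + m)"
  let ?D = "unbounded_sums S ?T Y"
  interpret SS: pair_prob_space S S ..
  have [measurable]: "Y \<in> borel_measurable S" using Y by simp
  have [measurable]: "?D \<in> sets S" by (rule unbounded_sums_sets) simp_all
  have split: "(\<integral>\<omega>. f \<omega> \<partial>S) = (\<integral>p. f (comb_seq m (fst p) (snd p)) \<partial>(S \<Otimes>\<^sub>M S))"
    if [measurable]: "f \<in> borel_measurable S" for f :: "(nat \<Rightarrow> 'a) \<Rightarrow> real"
    using integral_distr[OF measurable_comb_seq that, of m] by (simp add: PiM_comb_seq[unfolded split_beta'] split_beta')
  have ind: "indicator ?D (comb_seq m \<omega> \<omega>') = (indicator ?D \<omega>' :: real)"
    if "\<omega> \<in> space S" "\<omega>' \<in> space S" for \<omega> \<omega>'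
  proof -
    have "comb_seq m \<omega> \<omega>' \<in> space S"
      using measurable_space[OF measurable_comb_seq[of m M], of "(\<omega>, \<omega>')"] that
      by (simp add: space_pair_measure)
    from unbounded_sums_invariant[OF this measurable_shift[of m], of Y] show ?thesis
      by (simp add: comb_seq_add indicator_def)
  qed
  have DY: "integrable S (\<lambda>\<omega>. indicator ?D \<omega> * Y \<omega>)"
    using integrable_mult_indicator[OF _ Y, of ?D] by simp
  then have "integrable (S \<Otimes>\<^sub>M S) (\<lambda>p. indicator ?D (comb_seq m (fst p) (snd p)) * Y (comb_seq m (fst p) (snd p)))"
    using integrable_distr[OF measurable_comb_seq[of m M], of "\<lambda>\<omega>. indicator ?D \<omega> * Y \<omega>"]
    by (simp add: PiM_comb_seq[unfolded split_beta'] split_beta')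
  then have int: "integrable (S \<Otimes>\<^sub>M S) (\<lambda>p. indicator ?D (snd p) * Y (fst p))"
    by (rule Bochner_Integration.integrable_cong[THEN iffD1, rotated -1])
       (auto simp: loc ind space_pair_measure)
  have "0 \<le> (\<integral>\<omega>. indicator ?D \<omega> * Y \<omega> \<partial>S)"
    by (rule integral_unbounded_sums_nonneg[OF measurable_shift distr_shift Y])
  also have "\<dots> = (\<integral>p. indicator ?D (comb_seq m (fst p) (snd p)) * Y (comb_seq m (fst p) (snd p)) \<partial>(S \<Otimes>\<^sub>M S))"
    by (rule split) simp
  also have "\<dots> = (\<integral>p. indicator ?D (snd p) * Y (fst p) \<partial>(S \<Otimes>\<^sub>M S))"
    by (rule Bochner_Integration.integral_cong) (auto simp: loc ind space_pair_measure)
  also have "\<dots> = (\<integral>\<omega>. (\<integral>\<omega>'. indicator ?D \<omega>' * Y \<omega> \<partial>S) \<partial>S)"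
    using SS.integral_fst'[OF int] by simp
  also have "\<dots> = measure S ?D * (\<integral>\<omega>. Y \<omega> \<partial>S)"
    by simp
  finally have "measure S ?D = 0"
    using neg by (metis linorder_not_le measure_nonneg mult_pos_neg order_le_less)
  then have "AE \<omega> in S. \<omega> \<notin> ?D"
    by (subst AE_iff_measurable[of ?D])
       (auto simp: P.emeasure_eq_measure dest: sets.sets_into_space[OF \<open>?D \<in> sets S\<close>, THEN subsetD])
  moreover have "AE \<omega> in S. \<omega> \<in> space S" by simp
  ultimately show ?thesis
  proof eventually_elim
    case (elim \<omega>)
    then obtain c :: nat where c: "\<And>n. partial_max ?T Y n \<omega> \<le> real c"
      by (auto simp: unbounded_sums_def not_less)
    have iter: "(?T ^^ j) \<omega> = (\<lambda>i. \<omega> (i + j * m))" for j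
      by (induction j) (auto simp: add_ac)
    have "(\<Sum>j<n. Y (\<lambda>i. \<omega> (i + j * m))) \<le> real c" for n
      using sum_le_partial_max[of Y ?T \<omega> n] c[of n] by (simp add: iter)
    then show ?case by blast
  qed
qed

lemma distr_component: "distr S M (\<lambda>\<omega>. \<omega> i) = M"
  using distr_PiM_component[of UNIV "\<lambda>_. M" i] M.prob_space_axioms by simp

text \<open>
  The sums of \<open>V\<close> lie between \<open>n (E V - \<epsilon>/2)\<close> and \<open>n (E V + \<epsilon>/2)\<close> up to a random constant, and one
  value of \<open>V\<close> is the difference of two consecutive sums.
\<close>
lemma AE_sublinear_growth:
  fixes V :: "'a \<Rightarrow> real"
  assumes V: "integrable M V" and \<epsilon>: "0 < \<epsilon>"
  shows "AE \<omega> in S. \<exists>C. \<forall>n. V (\<omega> n) \<le> \<epsilon> * real n + C"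
proof -
  define E where "E = (\<integral>x. V x \<partial>M)"
  have [measurable]: "V \<in> borel_measurable M" using V by simp
  have m: "(\<lambda>\<omega>. \<omega> 0) \<in> measurable S M" by simp
  have Vint: "integrable S (\<lambda>\<omega>. V (\<omega> 0))"
    using integrable_distr[OF m, of V] V by (simp add: distr_component)
  have VE: "(\<integral>\<omega>. V (\<omega> 0) \<partial>S) = E"
    using integral_distr[OF m, of V] by (simp add: distr_component E_def)
  have "AE \<omega> in S. \<exists>C. \<forall>n. (\<Sum>j<n. V (\<omega> j) - (E + \<epsilon>/2)) \<le> C"
    using AE_sums_bounded_above[of "\<lambda>\<omega>. V (\<omega> 0) - (E + \<epsilon>/2)" 1] Vint \<epsilon>
    by (simp add: VE P.prob_space comb_seq_less)
  moreover have "AE \<omega> in S. \<exists>C. \<forall>n. (\<Sum>j<n. (E - \<epsilon>/2) - V (\<omega> j)) \<le> C"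
    using AE_sums_bounded_above[of "\<lambda>\<omega>. (E - \<epsilon>/2) - V (\<omega> 0)" 1] Vint \<epsilon>
    by (simp add: VE P.prob_space comb_seq_less)
  ultimately show ?thesis
  proof eventually_elim
    case (elim \<omega>)
    then obtain C1 C2 where C1: "\<And>n. (\<Sum>j<n. V (\<omega> j) - (E + \<epsilon>/2)) \<le> C1"
      and C2: "\<And>n. (\<Sum>j<n. (E - \<epsilon>/2) - V (\<omega> j)) \<le> C2" by blast
    have "V (\<omega> n) \<le> \<epsilon> * real n + (E + \<epsilon>/2 + C1 + C2)" for n
    proof -
      have "(\<Sum>j<Suc n. V (\<omega> j)) \<le> C1 + real (Suc n) * (E + \<epsilon>/2)"
        using C1[of "Suc n"] unfolding sum_subtractf by simp
      moreover have "real n * (E - \<epsilon>/2) \<le> C2 + (\<Sum>j<n. V (\<omega> j))"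
        using C2[of n] unfolding sum_subtractf by (simp add: algebra_simps)
      ultimately show ?thesis by (simp add: field_simps)
    qed
    then show ?case by blast
  qed
qed

end

section \<open>Logarithmic moments\<close>

lemma log_plus_nonneg: "0 \<le> log_plus x"
  by (simp add: log_plus_def)

lemma log_plus_le_iff: "0 \<le> x \<Longrightarrow> 0 \<le> s \<Longrightarrow> log_plus x \<le> s \<longleftrightarrow> x \<le> exp s"
proof (cases "x > 0")
  case True
  have "ln x \<le> s \<longleftrightarrow> x \<le> exp s" using True by (metis exp_le_cancel_iff exp_ln)
  then show "0 \<le> s \<Longrightarrow> ?thesis" using True by (simp add: log_plus_def)
qed (auto simp: log_plus_def intro: order_trans[OF _ exp_ge_zero])

lemma le_exp_log_plus: "0 \<le> x \<Longrightarrow> x \<le> exp (log_plus x)"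
  using log_plus_le_iff[of x "log_plus x"] log_plus_nonneg by simp

lemma log_plus_measurable [measurable]: "log_plus \<in> borel_measurable borel"
  unfolding log_plus_def by measurable

lemma e2ennreal_ext_log: "e2ennreal (ext_log x) = ennreal (log_plus x)"
  by (auto simp: ext_log_def log_plus_def max_def e2ennreal_ereal e2ennreal_neg ennreal_neg)

text \<open>
  The negative part of \<open>log q\<close> may have infinite integral, and \<open>log q\<close> may be \<open>-\<infinity>\<close>. Monotone
  convergence along the truncations of the negative part at height \<open>k\<close> yields some \<open>k\<close> for which it
  still outweighs the positive part; the constant is then \<open>c = exp (- k)\<close>.
\<close>
lemma truncated_log_integral_neg:
  fixes q :: "'a \<Rightarrow> real"
  assumes "prob_space M" and [measurable]: "q \<in> borel_measurable M" and q: "\<And>\<omega>. 0 \<le> q \<omega>"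
    and pos: "(\<integral>\<^sup>+\<omega>. ennreal (log_plus (q \<omega>)) \<partial>M) < \<infinity>"
    and neg: "ext_expectation M (\<lambda>\<omega>. ext_log (q \<omega>)) < 0"
  obtains c where "0 < c" "integrable M (\<lambda>\<omega>. ln (max c (q \<omega>)))" "(\<integral>\<omega>. ln (max c (q \<omega>)) \<partial>M) < 0"
proof -
  interpret prob_space M by fact
  \<comment> \<open>the negative part of the logarithm, cut off at height \<open>k\<close>\<close>
  define h where "h = (\<lambda>(k::nat) x::real. if x > 0 then min (real k) (max 0 (- ln x)) else real k)"
  have [measurable]: "h k \<in> borel_measurable borel" for k
    unfolding h_def by measurable
  have h_nonneg: "0 \<le> h k x" for k x by (simp add: h_def)
  have h_le: "h k x \<le> real k" for k x by (simp add: h_def)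
  have ln_eq: "ln (max (exp (- real k)) x) = log_plus x - h k x" if "0 \<le> x" for k x
  proof (cases "x \<le> exp (- real k)")
    case True
    have "- real k \<ge> ln x" if "0 < x"
      using True that by (metis ln_exp ln_le_cancel_iff exp_gt_zero)
    moreover have "x \<le> 1" using True by (rule order_trans) simp
    ultimately show ?thesis using True that by (auto simp: log_plus_def h_def max_def)
  next
    case False
    then have "0 < x" by (metis exp_gt_zero less_trans not_le)
    moreover have "- real k < ln x"
      using False \<open>0 < x\<close> by (metis exp_gt_zero ln_exp ln_less_cancel_iff not_le)
    ultimately
    show ?thesis using False by (auto simp: log_plus_def h_def max_def min_def)
  qed
  have sup_h: "e2ennreal (- ext_log x) = (SUP k. ennreal (h k x))" if "0 \<le> x" for x
  proof (cases "x > 0")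
    case True
    obtain b :: nat where b: "- ln x \<le> real b" using real_arch_simple by blast
    have "(SUP k. ennreal (h k x)) = ennreal (max 0 (- ln x))"
    proof (rule antisym)
      show "(SUP k. ennreal (h k x)) \<le> ennreal (max 0 (- ln x))"
        using True by (intro SUP_least ennreal_leI) (simp add: h_def)
      have "h b x = max 0 (- ln x)" using b True by (auto simp: h_def)
      then show "ennreal (max 0 (- ln x)) \<le> (SUP k. ennreal (h k x))"
        by (intro SUP_upper2[of b]) auto
    qed
    then show ?thesis using True
      by (auto simp: ext_log_def max_def e2ennreal_ereal ennreal_neg)
  next
    case False
    then show ?thesis
      by (simp add: ext_log_def h_def ennreal_SUP_of_nat_eq_top flip: ennreal_of_nat_eq_real_of_nat)
  qed
  let ?p = "\<integral>\<^sup>+\<omega>. ennreal (log_plus (q \<omega>)) \<partial>M"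
  let ?g = "\<integral>\<^sup>+\<omega>. e2ennreal (- ext_log (q \<omega>)) \<partial>M"
  have "?p < ?g"
  proof (rule ccontr)
    assume "\<not> ?p < ?g"
    then have "enn2ereal ?g \<le> enn2ereal ?p" by (simp add: not_less less_eq_ennreal.rep_eq)
    moreover have "enn2ereal ?p \<noteq> \<infinity>" using pos by (simp add: enn2ereal_eq_top_iff less_top)
    ultimately have "0 \<le> enn2ereal ?p - enn2ereal ?g"
      by (intro ereal_diff_positive) auto
    with neg show False by (simp add: ext_expectation_def e2ennreal_ext_log)
  qed
  also have "?g = (\<integral>\<^sup>+\<omega>. (SUP k. ennreal (h k (q \<omega>))) \<partial>M)"
    by (simp add: sup_h q)
  also have "\<dots> = (SUP k. \<integral>\<^sup>+\<omega>. ennreal (h k (q \<omega>)) \<partial>M)"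
    by (intro nn_integral_monotone_convergence_SUP)
       (auto intro!: incseq_SucI le_funI ennreal_leI simp: h_def)
  finally obtain k where k: "?p < (\<integral>\<^sup>+\<omega>. ennreal (h k (q \<omega>)) \<partial>M)"
    by (auto simp: less_SUP_iff)
  have int1: "integrable M (\<lambda>\<omega>. log_plus (q \<omega>))"
    using pos by (intro integrableI_nonneg) (auto simp: log_plus_nonneg)
  have int2: "integrable M (\<lambda>\<omega>. h k (q \<omega>))"
    using h_nonneg h_le by (intro integrable_const_bound[of _ "real k"]) (auto simp: abs_of_nonneg)
  have "ennreal (\<integral>\<omega>. log_plus (q \<omega>) \<partial>M) < ennreal (\<integral>\<omega>. h k (q \<omega>) \<partial>M)"
    using k by (simp add: nn_integral_eq_integral int1 int2 log_plus_nonneg h_nonneg)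
  then have lt: "(\<integral>\<omega>. log_plus (q \<omega>) \<partial>M) < (\<integral>\<omega>. h k (q \<omega>) \<partial>M)"
    by (simp add: ennreal_less_iff log_plus_nonneg)
  show thesis
  proof (rule that[of "exp (- real k)"])
    show "integrable M (\<lambda>\<omega>. ln (max (exp (- real k)) (q \<omega>)))"
      by (simp add: ln_eq q int1 int2)
    show "(\<integral>\<omega>. ln (max (exp (- real k)) (q \<omega>)) \<partial>M) < 0"
      using lt by (simp add: ln_eq q int1 int2)
  qed simp
qed

section \<open>Products of matrices\<close>

primrec prefix_prod :: "(nat \<Rightarrow> real^'n^'n) \<Rightarrow> nat \<Rightarrow> real^'n^'n" where
  "prefix_prod a 0 = mat 1"
| "prefix_prod a (Suc n) = prefix_prod a n ** a n"

lemma prefix_prod_add: "prefix_prod a (k + r) = prefix_prod a k ** prefix_prod (\<lambda>i. a (i + k)) r"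
  by (induction r) (simp_all add: matrix_mul_assoc add.commute)

lemma prefix_prod_Suc_front: "prefix_prod a (Suc n) = a 0 ** prefix_prod (\<lambda>i. a (Suc i)) n"
  using prefix_prod_add[of a 1 n] by simp

lemma prefix_prod_cong: "(\<And>i. i < n \<Longrightarrow> a i = b i) \<Longrightarrow> prefix_prod a n = prefix_prod b n"
  by (induction n) auto

lemma sq_opnorm_mult_le:
  fixes a b :: "real^'n^'n"
  assumes "(opnorm a)\<^sup>2 \<le> exp s" "(opnorm b)\<^sup>2 \<le> exp t"
  shows "(opnorm (a ** b))\<^sup>2 \<le> exp (s + t)"
proof -
  have "(opnorm (a ** b))\<^sup>2 \<le> (opnorm a * opnorm b)\<^sup>2"
    by (intro power_mono opnorm_mult opnorm_nonneg)
  also have "\<dots> \<le> exp s * exp t"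
    unfolding power_mult_distrib using assms by (intro mult_mono) auto
  finally show ?thesis by (simp add: exp_add)
qed

lemma sq_opnorm_prefix_prod_le:
  assumes "\<And>i. i < n \<Longrightarrow> (opnorm (a i))\<^sup>2 \<le> exp (s i)"
  shows "(opnorm (prefix_prod a n))\<^sup>2 \<le> exp (\<Sum>i<n. s i)"
  using assms
proof (induction n)
  case 0
  show ?case using power_le_one[OF opnorm_nonneg opnorm_one, of 2]
    by (simp only: prefix_prod.simps lessThan_0 mult_0 sum.empty exp_zero)
next
  case (Suc n)
  then show ?case by (simp add: sq_opnorm_mult_le)
qed

lemma sq_opnorm_prefix_prod_blocks_le:
  assumes "\<And>j. (opnorm (prefix_prod (\<lambda>i. a (i + j * m)) m))\<^sup>2 \<le> exp (y j)"
  shows "(opnorm (prefix_prod a (k * m)))\<^sup>2 \<le> exp (\<Sum>j<k. y j)"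
proof (induction k)
  case 0
  show ?case using power_le_one[OF opnorm_nonneg opnorm_one, of 2]
    by (simp only: prefix_prod.simps lessThan_0 mult_0 sum.empty exp_zero)
next
  case (Suc k)
  have "prefix_prod a (Suc k * m) = prefix_prod a (k * m) ** prefix_prod (\<lambda>i. a (i + k * m)) m"
    using prefix_prod_add[of a "k * m" m] by (simp add: add.commute)
  then show ?case using sq_opnorm_mult_le[OF Suc.IH assms[of k]] by simp
qed

text \<open>
  Cut \<open>n = k m + r\<close> with \<open>r < m\<close>: the \<open>k\<close> full blocks contribute the drift \<open>- \<delta> k\<close>, and the fewer
  than \<open>m\<close> left-over factors are bounded individually.
\<close>
lemma sq_opnorm_prefix_prod_decay:
  assumes m: "0 < m" and \<delta>: "0 \<le> \<delta>" and \<epsilon>: "0 \<le> \<epsilon>" and C2: "0 \<le> C2"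
    and blocks: "\<And>j. (opnorm (prefix_prod (\<lambda>i. a (i + j * m)) m))\<^sup>2 \<le> exp (y j)"
    and drift: "\<And>k. (\<Sum>j<k. y j) \<le> C1 - \<delta> * real k"
    and single: "\<And>i. (opnorm (a i))\<^sup>2 \<le> exp (\<epsilon> * real i + C2)"
  shows "(opnorm (prefix_prod a n))\<^sup>2 \<le> exp (C1 + \<delta> + real m * C2 - (\<delta> / real m - real m * \<epsilon>) * real n)"
proof -
  let ?k = "n div m" and ?r = "n mod m"
  have split: "prefix_prod a n = prefix_prod a (?k * m) ** prefix_prod (\<lambda>i. a (i + ?k * m)) ?r"
    using prefix_prod_add[of a "?k * m" ?r] by simp
  have "(opnorm (prefix_prod (\<lambda>i. a (i + ?k * m)) ?r))\<^sup>2 \<le> exp (\<Sum>i<?r. \<epsilon> * real n + C2)"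
  proof (rule sq_opnorm_prefix_prod_le)
    fix i assume "i < ?r"
    then have "i + ?k * m \<le> n"
      by (metis add.commute add_le_mono1 div_mult_mod_eq less_imp_le)
    then have "\<epsilon> * real (i + ?k * m) \<le> \<epsilon> * real n"
      using \<epsilon> by (intro mult_left_mono) (simp_all only: of_nat_le_iff)
    then have "exp (\<epsilon> * real (i + ?k * m) + C2) \<le> exp (\<epsilon> * real n + C2)" by simp
    with single[of "i + ?k * m"] show "(opnorm (a (i + ?k * m)))\<^sup>2 \<le> exp (\<epsilon> * real n + C2)"
      by (rule order_trans)
  qed
  from sq_opnorm_mult_le[OF sq_opnorm_prefix_prod_blocks_le[of a m y ?k, OF blocks] this]
  have "(opnorm (prefix_prod a n))\<^sup>2 \<le> exp ((\<Sum>j<?k. y j) + (\<Sum>i<?r. \<epsilon> * real n + C2))"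
    by (simp flip: split)
  also have "\<dots> \<le> exp (C1 + \<delta> + real m * C2 - (\<delta> / real m - real m * \<epsilon>) * real n)"
  proof -
    have "real n \<le> (real ?k + 1) * real m"
    proof -
      have "n \<le> (?k + 1) * m"
        using m by (metis add.commute dividend_less_div_times less_imp_le mult.commute mult_Suc Suc_eq_plus1)
      then show ?thesis by (metis of_nat_1 of_nat_add of_nat_le_iff of_nat_mult)
    qed
    then have "real n / real m \<le> real ?k + 1" using m by (simp add: field_simps)
    then have 1: "\<delta> * (real n / real m) \<le> \<delta> * (real ?k + 1)" using \<delta> by (rule mult_left_mono)
    have "real ?r \<le> real m" using m by (simp add: less_imp_le)
    then have 2: "real ?r * (\<epsilon> * real n + C2) \<le> real m * (\<epsilon> * real n + C2)"
      using \<epsilon> C2 by (intro mult_right_mono) auto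
    show ?thesis
      using 1 2 drift[of ?k] by (simp add: algebra_simps)
  qed
  finally show ?thesis .
qed

section \<open>Iterates of random affine maps\<close>

definition affine_step :: "(real^'n^'n) \<times> (real^'n^'n) \<Rightarrow> real^'n^'n \<Rightarrow> real^'n^'n" where
  "affine_step p x = fst p ** x ** transpose (fst p) + snd p"

text \<open>
  Forward iteration applies \<open>\<omega> 0\<close> first and \<open>\<omega> (n - 1)\<close> last; backward iteration uses the same
  maps in the opposite order.
\<close>
primrec forward :: "(nat \<Rightarrow> (real^'n^'n) \<times> (real^'n^'n)) \<Rightarrow> nat \<Rightarrow> real^'n^'n \<Rightarrow> real^'n^'n" where
  "forward \<omega> 0 x = x"
| "forward \<omega> (Suc n) x = affine_step (\<omega> n) (forward \<omega> n x)"

primrec backward :: "(nat \<Rightarrow> (real^'n^'n) \<times> (real^'n^'n)) \<Rightarrow> nat \<Rightarrow> real^'n^'n \<Rightarrow> real^'n^'n" where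
  "backward \<omega> 0 x = x"
| "backward \<omega> (Suc n) x = affine_step (\<omega> 0) (backward (\<lambda>i. \<omega> (Suc i)) n x)"

text \<open>
  Splitting off the first map instead of the last one is what allows conditioning on the first
  coordinate of \<open>\<omega>\<close> for both kinds of iteration.
\<close>
lemma forward_Suc_front: "forward \<omega> (Suc n) x = forward (\<lambda>i. \<omega> (Suc i)) n (affine_step (\<omega> 0) x)"
  by (induction n) simp_all

definition perpetuity_term :: "(nat \<Rightarrow> (real^'n^'n) \<times> (real^'n^'n)) \<Rightarrow> nat \<Rightarrow> real^'n^'n" where
  "perpetuity_term \<omega> n =
     prefix_prod (\<lambda>i. fst (\<omega> i)) n ** snd (\<omega> n) ** transpose (prefix_prod (\<lambda>i. fst (\<omega> i)) n)"

definition perpetuity :: "(nat \<Rightarrow> (real^'n^'n) \<times> (real^'n^'n)) \<Rightarrow> real^'n^'n" where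
  "perpetuity \<omega> = (\<Sum>n. perpetuity_term \<omega> n)"

lemma perpetuity_term_0: "perpetuity_term \<omega> 0 = snd (\<omega> 0)"
  by (simp add: perpetuity_term_def transpose_mat)

lemma perpetuity_term_Suc:
  "perpetuity_term \<omega> (Suc n) =
     fst (\<omega> 0) ** perpetuity_term (\<lambda>i. \<omega> (Suc i)) n ** transpose (fst (\<omega> 0))"
  unfolding perpetuity_term_def prefix_prod_Suc_front
  by (simp add: matrix_transpose_mul matrix_mul_assoc)

lemma matrix_mult_add_rdistrib: "(a + b) ** c = a ** c + b ** (c :: real^'n^'n)"
  for a b :: "real^'n^'n"
  by (simp add: matrix_matrix_mult_def vec_eq_iff sum.distrib distrib_right)

lemma bounded_linear_congruence: "bounded_linear (\<lambda>x. a ** x ** transpose a)"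
  for a :: "real^'n^'n"
proof (rule linear_conv_bounded_linear[THEN iffD1], rule linearI)
  fix x y :: "real^'n^'n" and r :: real
  show "a ** (x + y) ** transpose a = a ** x ** transpose a + a ** y ** transpose a"
    by (simp add: matrix_add_ldistrib matrix_mult_add_rdistrib)
  show "a ** (r *\<^sub>R x) ** transpose a = r *\<^sub>R (a ** x ** transpose a)"
    by (simp add: matrix_scalar_ac flip: scalar_matrix_assoc)
qed

lemma backward_eq_partial_sum:
  "backward \<omega> n x = (\<Sum>i<n. perpetuity_term \<omega> i) +
     prefix_prod (\<lambda>i. fst (\<omega> i)) n ** x ** transpose (prefix_prod (\<lambda>i. fst (\<omega> i)) n)"
proof (induction n arbitrary: \<omega>)
  case 0
  show ?case by (simp add: transpose_mat)
next
  case (Suc n)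
  interpret bounded_linear "\<lambda>x. fst (\<omega> 0) ** x ** transpose (fst (\<omega> 0))"
    by (rule bounded_linear_congruence)
  show ?case
    unfolding backward.simps Suc.IH affine_step_def add sum sum.lessThan_Suc_shift
      perpetuity_term_0 perpetuity_term_Suc prefix_prod_Suc_front
    by (simp add: matrix_transpose_mul matrix_mul_assoc)
qed

lemma perpetuity_unfold:
  assumes "summable (perpetuity_term (\<lambda>i. \<omega> (Suc i)))"
  shows "perpetuity \<omega> = affine_step (\<omega> 0) (perpetuity (\<lambda>i. \<omega> (Suc i)))"
proof -
  interpret bounded_linear "\<lambda>x. fst (\<omega> 0) ** x ** transpose (fst (\<omega> 0))"
    by (rule bounded_linear_congruence)
  have "(\<lambda>n. perpetuity_term \<omega> (Suc n)) sums
      (fst (\<omega> 0) ** perpetuity (\<lambda>i. \<omega> (Suc i)) ** transpose (fst (\<omega> 0)))"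
    unfolding perpetuity_term_Suc perpetuity_def by (intro sums summable_sums assms)
  then have "perpetuity_term \<omega> sums
      (fst (\<omega> 0) ** perpetuity (\<lambda>i. \<omega> (Suc i)) ** transpose (fst (\<omega> 0)) + perpetuity_term \<omega> 0)"
    by (rule sums_Suc)
  then show ?thesis
    by (simp add: perpetuity_def[of \<omega>] sums_iff affine_step_def perpetuity_term_0)
qed

lemma borel_measurable_matrix_mult [measurable (raw)]:
  fixes f g :: "'a \<Rightarrow> real^'n^'n"
  assumes "f \<in> borel_measurable M" "g \<in> borel_measurable M"
  shows "(\<lambda>w. f w ** g w) \<in> borel_measurable M"
  using assms by (rule borel_measurable_continuous_Pair)
    (intro continuous_matrix_mult continuous_intros)

lemma borel_measurable_transpose [measurable (raw)]:
  fixes f :: "'a \<Rightarrow> real^'n^'n"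
  assumes "f \<in> borel_measurable M"
  shows "(\<lambda>w. transpose (f w)) \<in> borel_measurable M"
  using assms by (rule borel_measurable_continuous_on[rotated]) (intro continuous_transpose continuous_intros)

lemma borel_measurable_fst [measurable (raw)]:
  fixes f :: "'a \<Rightarrow> 'b::topological_space \<times> 'c::topological_space"
  assumes "f \<in> borel_measurable M"
  shows "(\<lambda>w. fst (f w)) \<in> borel_measurable M"
  using assms by (rule borel_measurable_continuous_on[rotated]) (intro continuous_intros)

lemma borel_measurable_snd [measurable (raw)]:
  fixes f :: "'a \<Rightarrow> 'b::topological_space \<times> 'c::topological_space"
  assumes "f \<in> borel_measurable M"
  shows "(\<lambda>w. snd (f w)) \<in> borel_measurable M"
  using assms by (rule borel_measurable_continuous_on[rotated]) (intro continuous_intros)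

lemma borel_measurable_affine_step [measurable (raw)]:
  assumes [measurable]: "f \<in> borel_measurable M" "g \<in> borel_measurable M"
  shows "(\<lambda>w. affine_step (f w) (g w)) \<in> borel_measurable M"
  unfolding affine_step_def by measurable

lemma borel_measurable_prefix_prod [measurable (raw)]:
  assumes "\<And>i. (\<lambda>w. f w i) \<in> borel_measurable M"
  shows "(\<lambda>w. prefix_prod (f w) n) \<in> borel_measurable M"
proof (induction n)
  case (Suc n)
  note [measurable] = Suc.IH assms
  show ?case by simp
qed simp

lemma borel_measurable_forward:
  assumes "\<And>i. (\<lambda>w. f w i) \<in> borel_measurable M" and g: "g \<in> borel_measurable M"
  shows "(\<lambda>w. forward (f w) n (g w)) \<in> borel_measurable M"
proof (induction n)
  case (Suc n)
  note [measurable] = Suc.IH assms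
  show ?case by simp
qed (simp add: g)

lemma borel_measurable_backward:
  assumes "\<And>i. (\<lambda>w. f w i) \<in> borel_measurable M" and g: "g \<in> borel_measurable M"
  shows "(\<lambda>w. backward (f w) n (g w)) \<in> borel_measurable M"
  using assms(1)
proof (induction n arbitrary: f)
  case (Suc n)
  have [measurable]: "(\<lambda>w. backward (\<lambda>i. f w (Suc i)) n (g w)) \<in> borel_measurable M"
    by (rule Suc.IH) (rule Suc.prems)
  note [measurable] = Suc.prems
  show ?case by simp
qed (simp add: g)

lemma borel_measurable_perpetuity:
  assumes [measurable]: "\<And>i. (\<lambda>w. f w i) \<in> borel_measurable M"
  shows "(\<lambda>w. perpetuity (f w)) \<in> borel_measurable M"
  unfolding perpetuity_def perpetuity_term_def by measurable

section \<open>Laws determined by their integrals\<close>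

lemma distr_borel_eqI:
  assumes [measurable]: "f \<in> borel_measurable N" "g \<in> borel_measurable N'"
    and eq: "\<And>h. h \<in> borel_measurable borel \<Longrightarrow> (\<integral>\<^sup>+w. h (f w) \<partial>N) = (\<integral>\<^sup>+w. h (g w) \<partial>N')"
  shows "distr N borel f = distr N' borel g"
proof (rule measure_eqI)
  fix U assume "U \<in> sets (distr N borel f)"
  then have [measurable]: "U \<in> sets borel" by simp
  have "emeasure (distr N borel f) U = (\<integral>\<^sup>+x. indicator U x \<partial>distr N borel f)" by simp
  also have "\<dots> = (\<integral>\<^sup>+w. indicator U (f w) \<partial>N)" by (rule nn_integral_distr) simp_all
  also have "\<dots> = (\<integral>\<^sup>+w. indicator U (g w) \<partial>N')" by (rule eq) simp
  also have "\<dots> = (\<integral>\<^sup>+x. indicator U x \<partial>distr N' borel g)"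
    by (rule nn_integral_distr[symmetric]) simp_all
  also have "\<dots> = emeasure (distr N' borel g) U" by simp
  finally show "emeasure (distr N borel f) U = emeasure (distr N' borel g) U" .
qed simp

text \<open>
  The indicator of a closed set is the limit of the bounded continuous functions
  \<open>max 0 (1 - k d(x, C))\<close>, and closed sets form an intersection-stable generator of the Borel sets.
\<close>
lemma measure_eqI_bounded_continuous:
  fixes \<mu> \<mu>' :: "'a::metric_space measure"
  assumes "prob_space \<mu>" "prob_space \<mu>'" and [measurable_cong]: "sets \<mu> = sets borel" "sets \<mu>' = sets borel"
    and eq: "\<And>f :: 'a \<Rightarrow> real. continuous_on UNIV f \<Longrightarrow> bounded (range f) \<Longrightarrow> (\<integral>x. f x \<partial>\<mu>) = (\<integral>x. f x \<partial>\<mu>')"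
  shows "\<mu> = \<mu>'"
proof -
  interpret m: prob_space \<mu> by fact
  interpret m': prob_space \<mu>' by fact
  have closed_eq: "emeasure \<mu> C = emeasure \<mu>' C" if C: "closed C" for C :: "'a set"
  proof (cases "C = {}")
    case False
    define f where "f = (\<lambda>k::nat. \<lambda>x. max 0 (1 - real k * infdist x C))"
    have cont: "continuous_on UNIV (f k)" for k
      unfolding f_def by (intro continuous_intros)
    have [measurable]: "f k \<in> borel_measurable borel" for k
      by (rule borel_measurable_continuous_onI[OF cont])
    have range: "0 \<le> f k x" "f k x \<le> 1" for k x
      by (auto simp: f_def infdist_nonneg)
    have bdd: "bounded (range (f k))" for k
      unfolding bounded_iff using range[of k] by (intro exI[of _ 1]) auto
    have [measurable]: "C \<in> sets borel" using C by simp
    have pointwise: "(\<lambda>k. f k x) \<longlonglongrightarrow> indicator C x" for x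
    proof (cases "x \<in> C")
      case False
      then have pos: "0 < infdist x C"
        using C \<open>C \<noteq> {}\<close> by (simp add: infdist_pos_not_in_closed)
      then obtain k0 :: nat where "1 / infdist x C \<le> real k0" using real_arch_simple by blast
      then have k0: "1 \<le> real k0 * infdist x C" using pos by (simp add: field_simps)
      have "f k x = indicator C x" if "k0 \<le> k" for k
      proof -
        have "real k0 * infdist x C \<le> real k * infdist x C"
          using that pos by (intro mult_right_mono) auto
        with k0 False show ?thesis by (simp add: f_def)
      qed
      then show ?thesis by (intro tendsto_eventually eventually_sequentiallyI[of k0])
    qed (simp add: f_def)
    have lim: "(\<lambda>k. \<integral>x. f k x \<partial>N) \<longlonglongrightarrow> measure N C"
      if "prob_space N" and [measurable_cong]: "sets N = sets borel" for N
    proof -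
      interpret N: prob_space N by fact
      have "(\<lambda>k. \<integral>x. f k x \<partial>N) \<longlonglongrightarrow> (\<integral>x. indicator C x \<partial>N)"
        by (rule integral_dominated_convergence[where w="\<lambda>_. 1"])
           (use pointwise range in auto)
      then show ?thesis by simp
    qed
    have "measure \<mu> C = measure \<mu>' C"
      using lim[of \<mu>] lim[of \<mu>'] assms(1-4) eq[OF cont bdd]
      by (simp add: LIMSEQ_unique)
    then show ?thesis by (simp add: m.emeasure_eq_measure m'.emeasure_eq_measure)
  qed simp
  show ?thesis
  proof (rule measure_eqI_generator_eq[where \<Omega>=UNIV and E="Collect closed" and A="\<lambda>_. UNIV"])
    show "Int_stable (Collect closed :: 'a set set)" by (auto simp: Int_stable_def)
    show "sets \<mu> = sigma_sets UNIV (Collect closed)"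
      by (simp add: assms(3) borel_eq_closed)
    show "sets \<mu>' = sigma_sets UNIV (Collect closed)"
      by (simp add: assms(4) borel_eq_closed)
  qed (auto simp: closed_eq)
qed

lemma weak_conv_laws_unique:
  fixes \<mu> \<mu>' :: "'a::real_normed_vector measure"
  assumes "prob_space \<mu>" "prob_space \<mu>'" "sets \<mu> = sets borel" "sets \<mu>' = sets borel"
    and "weak_conv_laws (\<lambda>_. \<mu>') \<mu>"
  shows "\<mu>' = \<mu>"
proof (rule measure_eqI_bounded_continuous)
  fix f :: "'a \<Rightarrow> real" assume "continuous_on UNIV f" "bounded (range f)"
  then have "(\<lambda>n::nat. \<integral>x. f x \<partial>\<mu>') \<longlonglongrightarrow> (\<integral>x. f x \<partial>\<mu>)"
    using assms(5) by (simp add: weak_conv_laws_def)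
  then show "(\<integral>x. f x \<partial>\<mu>') = (\<integral>x. f x \<partial>\<mu>)"
    by (simp add: LIMSEQ_const_iff)
qed fact+

section \<open>The contractive recursion on sequence space\<close>

text \<open>
  The situation extracted from the hypotheses of the theorem: \<open>\<nu>\<close> is the law of \<open>(A, B)\<close>, and
  \<open>S\<close> is the space of i.i.d. sequences with this law, indexed from \<open>0\<close>. Negativity of the Lyapunov
  exponent enters as the negative mean of one truncated logarithm for the block length \<open>m\<close>.
\<close>
locale contractive_recursion = sequence_space \<nu>
  for \<nu> :: "((real^'n^'n) \<times> (real^'n^'n)) measure" +
  fixes m :: nat and c :: real
  assumes sets_law [measurable_cong]: "sets \<nu> = sets borel"
    and log_A: "integrable \<nu> (\<lambda>p. log_plus ((opnorm (fst p))\<^sup>2))"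
    and log_B: "integrable \<nu> (\<lambda>p. log_plus ((opnorm (snd p))\<^sup>2))"
    and m_pos: "0 < m" and c_pos: "0 < c"
    and block_integrable: "integrable S (\<lambda>\<omega>. ln (max c ((opnorm (prefix_prod (\<lambda>i. fst (\<omega> i)) m))\<^sup>2)))"
    and block_neg: "(\<integral>\<omega>. ln (max c ((opnorm (prefix_prod (\<lambda>i. fst (\<omega> i)) m))\<^sup>2)) \<partial>S) < 0"
begin

sublocale nuS: pair_prob_space \<nu> S ..

lemma measurable_coordinate [measurable]: "(\<lambda>\<omega>. \<omega> i) \<in> borel_measurable S"
  using measurable_component_singleton[of i UNIV "\<lambda>_. \<nu>"] by (simp cong: measurable_cong_sets add: sets_law)

text \<open>
  The two rates are matched so that the terms of the series, being bounded by the product of both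
  expressions, decay like \<open>exp (- r n)\<close>.
\<close>
lemma AE_decay:
  obtains r where "0 < r"
    "AE \<omega> in S. \<exists>C. \<forall>n. (opnorm (prefix_prod (\<lambda>i. fst (\<omega> i)) n))\<^sup>2 \<le> exp (C - 2 * r * real n)
       \<and> norm (snd (\<omega> n)) \<le> exp (C + r * real n)"
proof -
  define Y where "Y = (\<lambda>\<omega>::nat \<Rightarrow> (real^'n^'n) \<times> (real^'n^'n). ln (max c ((opnorm (prefix_prod (\<lambda>i. fst (\<omega> i)) m))\<^sup>2)))"
  (* Half of the drift is held back: Y + \<delta> still has negative mean, and a bound on its sums gives
     the sums of Y the slope -\<delta>, that is -4 r per factor. The incomplete block costs at most r per
     factor with this choice of \<epsilon>. *)
  define \<delta> where "\<delta> = - (\<integral>\<omega>. Y \<omega> \<partial>S) / 2"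
  have Y: "integrable S Y" using block_integrable by (simp add: Y_def)
  have \<delta>: "0 < \<delta>" using block_neg by (simp add: \<delta>_def Y_def)
  define r where "r = \<delta> / (4 * real m)"
  have r: "0 < r" using \<delta> m_pos by (simp add: r_def)
  define \<epsilon> where "\<epsilon> = r / real m"
  have \<epsilon>: "0 < \<epsilon>" using r m_pos by (simp add: \<epsilon>_def)
  have rate: "\<delta> / real m - real m * \<epsilon> = 3 * r"
    using m_pos by (simp add: r_def \<epsilon>_def field_simps)
  have "AE \<omega> in S. \<exists>C. \<forall>k. (\<Sum>j<k. Y (\<lambda>i. \<omega> (i + j * m)) + \<delta>) \<le> C"
  proof (rule AE_sums_bounded_above)
    show "integrable S (\<lambda>\<omega>. Y \<omega> + \<delta>)" using Y by simp
    have "(\<integral>\<omega>. Y \<omega> + \<delta> \<partial>S) = - 2 * \<delta> + \<delta>" using Y by (simp add: P.prob_space \<delta>_def)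
    then show "(\<integral>\<omega>. Y \<omega> + \<delta> \<partial>S) < 0" using \<delta> by simp
    show "Y (comb_seq m \<omega> \<omega>') + \<delta> = Y \<omega> + \<delta>" for \<omega> \<omega>'
      using prefix_prod_cong[of m "\<lambda>i. fst (comb_seq m \<omega> \<omega>' i)" "\<lambda>i. fst (\<omega> i)"]
      by (simp add: Y_def comb_seq_less)
  qed
  moreover have "AE \<omega> in S. \<exists>C. \<forall>n. log_plus ((opnorm (fst (\<omega> n)))\<^sup>2) \<le> \<epsilon> * real n + C"
    by (rule AE_sublinear_growth[OF log_A \<epsilon>])
  moreover have "AE \<omega> in S. \<exists>C. \<forall>n. log_plus ((opnorm (snd (\<omega> n)))\<^sup>2) \<le> r * real n + C"
    by (rule AE_sublinear_growth[OF log_B r])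
  ultimately have "AE \<omega> in S. \<exists>C. \<forall>n. (opnorm (prefix_prod (\<lambda>i. fst (\<omega> i)) n))\<^sup>2 \<le> exp (C - 2 * r * real n)
       \<and> norm (snd (\<omega> n)) \<le> exp (C + r * real n)"
  proof eventually_elim
    case (elim \<omega>)
    then obtain C1 C2 C3
      where C1: "\<And>k. (\<Sum>j<k. Y (\<lambda>i. \<omega> (i + j * m)) + \<delta>) \<le> C1"
        and C2: "\<And>n. log_plus ((opnorm (fst (\<omega> n)))\<^sup>2) \<le> \<epsilon> * real n + C2"
        and C3: "\<And>n. log_plus ((opnorm (snd (\<omega> n)))\<^sup>2) \<le> r * real n + C3" by blast
    have C2_nonneg: "0 \<le> C2" using C2[of 0] log_plus_nonneg[of "(opnorm (fst (\<omega> 0)))\<^sup>2"] by simp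
    let ?C = "C1 + \<delta> + real m * C2" and ?D = "ln ((real CARD('n))\<^sup>2) + C3"
    have decay: "(opnorm (prefix_prod (\<lambda>i. fst (\<omega> i)) n))\<^sup>2 \<le> exp (?C - 3 * r * real n)" for n
      unfolding rate[symmetric]
    proof (rule sq_opnorm_prefix_prod_decay[where y="\<lambda>j. Y (\<lambda>i. \<omega> (i + j * m))"])
      show "(opnorm (prefix_prod (\<lambda>i. fst (\<omega> (i + j * m))) m))\<^sup>2 \<le> exp (Y (\<lambda>i. \<omega> (i + j * m)))" for j
        using c_pos by (simp add: Y_def)
      show "(\<Sum>j<k. Y (\<lambda>i. \<omega> (i + j * m))) \<le> C1 - \<delta> * real k" for k
        using C1[of k] by (simp add: sum.distrib mult.commute)
      show "(opnorm (fst (\<omega> i)))\<^sup>2 \<le> exp (\<epsilon> * real i + C2)" for i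
        using C2[of i] C2_nonneg \<epsilon> by (subst log_plus_le_iff[symmetric]) auto
    qed (use m_pos \<delta> \<epsilon> C2_nonneg in auto)
    have growth: "norm (snd (\<omega> n)) \<le> exp (?D + r * real n)" for n
    proof -
      let ?b = "opnorm (snd (\<omega> n))"
      have nonneg: "0 \<le> r * real n + C3"
        using C3[of n] log_plus_nonneg order_trans by blast
      have "?b\<^sup>2 \<le> exp (r * real n + C3)"
        using C3[of n] nonneg by (subst log_plus_le_iff[symmetric]) auto
      moreover have "?b \<le> max 1 (?b\<^sup>2)"
        using opnorm_nonneg[of "snd (\<omega> n)"] by (cases "?b \<le> 1") (auto simp: power2_eq_square le_max_iff_disj)
      moreover have "1 \<le> exp (r * real n + C3)" using nonneg by simp
      ultimately have "?b \<le> exp (r * real n + C3)" by linarith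
      then have "(real CARD('n))\<^sup>2 * ?b \<le> (real CARD('n))\<^sup>2 * exp (r * real n + C3)"
        by (intro mult_left_mono) auto
      with norm_le_opnorm[of "snd (\<omega> n)"] have "norm (snd (\<omega> n)) \<le> (real CARD('n))\<^sup>2 * exp (r * real n + C3)"
        by (rule order_trans)
      also have "\<dots> = exp (ln ((real CARD('n))\<^sup>2)) * exp (r * real n + C3)"
        by (simp only: exp_ln zero_less_power of_nat_0_less_iff zero_less_card_finite)
      finally show ?thesis by (simp only: exp_add[symmetric] add_ac)
    qed
    show ?case
    proof (intro exI[of _ "max ?C ?D"] allI conjI)
      fix n
      have "0 \<le> r * real n" using r by simp
      then have "?C - 3 * r * real n \<le> max ?C ?D - 2 * r * real n" by linarith
      then show "(opnorm (prefix_prod (\<lambda>i. fst (\<omega> i)) n))\<^sup>2 \<le> exp (max ?C ?D - 2 * r * real n)"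
        using decay[of n] by (meson exp_le_cancel_iff order_trans)
      have "?D + r * real n \<le> max ?C ?D + r * real n" by simp
      then show "norm (snd (\<omega> n)) \<le> exp (max ?C ?D + r * real n)"
        using growth[of n] by (meson exp_le_cancel_iff order_trans)
    qed
  qed
  with r show thesis by (rule that)
qed

text \<open>
  The backward iterate is a partial sum of the series plus a remainder in which the starting point
  is multiplied by products that tend to \<open>0\<close>. The exceptional null set is the same for all starting
  points.
\<close>
lemma AE_backward_converges:
  "AE \<omega> in S. summable (perpetuity_term \<omega>) \<and> (\<forall>x. (\<lambda>n. backward \<omega> n x) \<longlonglongrightarrow> perpetuity \<omega>)"
proof -
  obtain r where r: "0 < r" and "AE \<omega> in S. \<exists>C. \<forall>n.
      (opnorm (prefix_prod (\<lambda>i. fst (\<omega> i)) n))\<^sup>2 \<le> exp (C - 2 * r * real n)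
      \<and> norm (snd (\<omega> n)) \<le> exp (C + r * real n)"
    by (rule AE_decay)
  from this(2) show ?thesis
  proof eventually_elim
    case (elim \<omega>)
    then obtain C where
      A: "\<And>n. (opnorm (prefix_prod (\<lambda>i. fst (\<omega> i)) n))\<^sup>2 \<le> exp (C - 2 * r * real n)" and
      B: "\<And>n. norm (snd (\<omega> n)) \<le> exp (C + r * real n)" by blast
    let ?L = "\<lambda>n. prefix_prod (\<lambda>i. fst (\<omega> i)) n" and ?K = "(real CARD('n))^4"
    have geo: "exp (b - d * real n) = exp b * exp (- d) ^ n" for b d :: real and n
      by (simp add: exp_diff exp_minus field_simps flip: exp_of_nat_mult)
    have "norm (perpetuity_term \<omega> n) \<le> ?K * exp (2 * C) * exp (- r) ^ n" for n
    proof -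
      have "norm (perpetuity_term \<omega> n) \<le> ?K * (opnorm (?L n))\<^sup>2 * norm (snd (\<omega> n))"
        unfolding perpetuity_term_def by (rule norm_congruence_le)
      also have "\<dots> \<le> ?K * exp (C - 2 * r * real n) * exp (C + r * real n)"
        by (intro mult_mono mult_left_mono A B mult_nonneg_nonneg) auto
      also have "\<dots> = ?K * exp (2 * C - r * real n)"
        by (simp add: mult.assoc flip: exp_add)
      finally show ?thesis by (simp add: geo)
    qed
    moreover have "summable (\<lambda>n. ?K * exp (2 * C) * exp (- r) ^ n)"
      using r by (intro summable_mult summable_geometric) simp
    ultimately have summable: "summable (perpetuity_term \<omega>)"
      by (metis summable_comparison_test')
    have "(\<lambda>n. backward \<omega> n x) \<longlonglongrightarrow> perpetuity \<omega>" for x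
    proof -
      have "(\<lambda>n. ?L n ** x ** transpose (?L n)) \<longlonglongrightarrow> 0"
      proof (rule Lim_null_comparison)
        show "\<forall>\<^sub>F n in sequentially. norm (?L n ** x ** transpose (?L n))
            \<le> ?K * exp C * norm x * exp (- (2 * r)) ^ n"
        proof (rule always_eventually, rule allI)
          fix n
          have "norm (?L n ** x ** transpose (?L n)) \<le> ?K * (opnorm (?L n))\<^sup>2 * norm x"
            by (rule norm_congruence_le)
          also have "\<dots> \<le> ?K * exp (C - 2 * r * real n) * norm x"
            by (intro mult_right_mono mult_left_mono A) auto
          finally show "norm (?L n ** x ** transpose (?L n)) \<le> ?K * exp C * norm x * exp (- (2 * r)) ^ n"
            unfolding geo by (simp only: mult_ac)
        qed
        show "(\<lambda>n. ?K * exp C * norm x * exp (- (2 * r)) ^ n) \<longlonglongrightarrow> 0"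
          using r by (intro tendsto_mult_right_zero LIMSEQ_realpow_zero) auto
      qed
      moreover have "(\<lambda>n. \<Sum>i<n. perpetuity_term \<omega> i) \<longlonglongrightarrow> perpetuity \<omega>"
        unfolding perpetuity_def by (rule summable_LIMSEQ[OF summable])
      ultimately show ?thesis
        unfolding backward_eq_partial_sum using tendsto_add by fastforce
    qed
    with summable show ?case by blast
  qed
qed

text \<open>
  The Markov operator of the chain \<open>X\<^sub>n = A\<^sub>n X\<^sub>n\<^sub>-\<^sub>1 A\<^sub>n\<^sup>T + B\<^sub>n\<close>. Forward and backward iteration
  both lead to its \<open>n\<close>-th power: conditioning on the first coordinate applies the operator on the
  outside in the forward case and on the inside in the backward case.
\<close>
definition transition :: "(real^'n^'n \<Rightarrow> ennreal) \<Rightarrow> real^'n^'n \<Rightarrow> ennreal" where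
  "transition f x = (\<integral>\<^sup>+p. f (affine_step p x) \<partial>\<nu>)"

lemma measurable_transition [measurable]:
  assumes [measurable]: "f \<in> borel_measurable borel"
  shows "transition f \<in> borel_measurable borel"
  unfolding transition_def by measurable

lemma measurable_transition_funpow:
  "f \<in> borel_measurable borel \<Longrightarrow> (transition ^^ n) f \<in> borel_measurable borel"
  by (induction n) (auto intro: measurable_transition)

lemma measurable_case_nat_pair: "(\<lambda>q. case_nat (fst q) (snd q)) \<in> measurable (\<nu> \<Otimes>\<^sub>M S) S"
  by (rule measurable_case_nat') simp_all

lemma nn_integral_first_step:
  assumes [measurable]: "f \<in> borel_measurable S"
  shows "(\<integral>\<^sup>+\<omega>. f \<omega> \<partial>S) = (\<integral>\<^sup>+p. \<integral>\<^sup>+\<omega>. f (case_nat p \<omega>) \<partial>S \<partial>\<nu>)"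
proof -
  note [measurable] = measurable_case_nat_pair
  have "(\<integral>\<^sup>+\<omega>. f \<omega> \<partial>S) = (\<integral>\<^sup>+\<omega>. f \<omega> \<partial>distr (\<nu> \<Otimes>\<^sub>M S) S (\<lambda>q. case_nat (fst q) (snd q)))"
    using PiM_iter by (simp add: split_beta')
  also have "\<dots> = (\<integral>\<^sup>+q. f (case_nat (fst q) (snd q)) \<partial>(\<nu> \<Otimes>\<^sub>M S))"
    by (rule nn_integral_distr) simp_all
  also have "\<dots> = (\<integral>\<^sup>+p. \<integral>\<^sup>+\<omega>. f (case_nat p \<omega>) \<partial>S \<partial>\<nu>)"
    by (subst P.nn_integral_fst[symmetric]) simp_all
  finally show ?thesis .
qed

lemma nn_integral_backward:
  assumes "f \<in> borel_measurable borel"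
  shows "(\<integral>\<^sup>+\<omega>. f (backward \<omega> n x) \<partial>S) = (transition ^^ n) f x"
  using assms
proof (induction n arbitrary: f)
  case 0
  show ?case by (simp add: P.emeasure_space_1)
next
  case (Suc n)
  note [measurable] = Suc.prems borel_measurable_backward
  have "(\<integral>\<^sup>+\<omega>. f (backward \<omega> (Suc n) x) \<partial>S)
      = (\<integral>\<^sup>+p. \<integral>\<^sup>+\<omega>. f (affine_step p (backward \<omega> n x)) \<partial>S \<partial>\<nu>)"
    by (subst nn_integral_first_step) simp_all
  also have "\<dots> = (\<integral>\<^sup>+\<omega>. transition f (backward \<omega> n x) \<partial>S)"
    unfolding transition_def by (rule nuS.Fubini'[symmetric]) simp
  also have "\<dots> = (transition ^^ Suc n) f x"
    by (subst Suc.IH) (simp_all add: funpow_swap1)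
  finally show ?case .
qed

lemma nn_integral_forward:
  assumes [measurable]: "f \<in> borel_measurable borel"
  shows "(\<integral>\<^sup>+\<omega>. f (forward \<omega> n x) \<partial>S) = (transition ^^ n) f x"
proof (induction n arbitrary: x)
  case 0
  show ?case by (simp add: P.emeasure_space_1)
next
  case (Suc n)
  note [measurable] = borel_measurable_forward
  have "(\<integral>\<^sup>+\<omega>. f (forward \<omega> (Suc n) x) \<partial>S)
      = (\<integral>\<^sup>+p. \<integral>\<^sup>+\<omega>. f (forward \<omega> n (affine_step p x)) \<partial>S \<partial>\<nu>)"
    unfolding forward_Suc_front by (subst nn_integral_first_step) (simp_all del: forward.simps)
  also have "\<dots> = (transition ^^ Suc n) f x"
    by (simp add: Suc.IH transition_def[where f="(transition ^^ n) f"])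
  finally show ?case .
qed

text \<open>
  Below, \<open>\<mu>\<^sub>0\<close> is the law of the starting point, which is independent of the sequence of maps.
\<close>
context
  fixes \<mu>\<^sub>0 :: "(real^'n^'n) measure"
  assumes prob_init: "prob_space \<mu>\<^sub>0" and sets_init [measurable_cong]: "sets \<mu>\<^sub>0 = sets borel"
begin

interpretation init: prob_space \<mu>\<^sub>0 by (rule prob_init)
interpretation Sinit: pair_prob_space S \<mu>\<^sub>0 ..

lemma measurable_path [measurable]: "(\<lambda>q. fst q i) \<in> borel_measurable (S \<Otimes>\<^sub>M \<mu>\<^sub>0)"
  using measurable_compose[OF measurable_fst measurable_coordinate] by simp

lemma measurable_start [measurable]: "snd \<in> borel_measurable (S \<Otimes>\<^sub>M \<mu>\<^sub>0)"
  using measurable_snd[of S \<mu>\<^sub>0] by (simp cong: measurable_cong_sets add: sets_init)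

lemma nn_integral_init_backward:
  assumes [measurable]: "f \<in> borel_measurable borel"
  shows "(\<integral>\<^sup>+q. f (backward (fst q) n (snd q)) \<partial>(S \<Otimes>\<^sub>M \<mu>\<^sub>0)) = (\<integral>\<^sup>+x. (transition ^^ n) f x \<partial>\<mu>\<^sub>0)"
proof -
  note [measurable] = borel_measurable_backward
  have "(\<integral>\<^sup>+q. f (backward (fst q) n (snd q)) \<partial>(S \<Otimes>\<^sub>M \<mu>\<^sub>0)) = (\<integral>\<^sup>+x. \<integral>\<^sup>+\<omega>. f (backward \<omega> n x) \<partial>S \<partial>\<mu>\<^sub>0)"
    by (subst Sinit.nn_integral_snd[symmetric]) simp_all
  then show ?thesis by (simp add: nn_integral_backward)
qed

lemma nn_integral_init_forward:
  assumes [measurable]: "f \<in> borel_measurable borel"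
  shows "(\<integral>\<^sup>+q. f (forward (fst q) n (snd q)) \<partial>(S \<Otimes>\<^sub>M \<mu>\<^sub>0)) = (\<integral>\<^sup>+x. (transition ^^ n) f x \<partial>\<mu>\<^sub>0)"
proof -
  note [measurable] = borel_measurable_forward
  have "(\<integral>\<^sup>+q. f (forward (fst q) n (snd q)) \<partial>(S \<Otimes>\<^sub>M \<mu>\<^sub>0)) = (\<integral>\<^sup>+x. \<integral>\<^sup>+\<omega>. f (forward \<omega> n x) \<partial>S \<partial>\<mu>\<^sub>0)"
    by (subst Sinit.nn_integral_snd[symmetric]) simp_all
  then show ?thesis by (simp add: nn_integral_forward)
qed

text \<open>
  Only the laws for fixed \<open>n\<close> agree: the backward iterates converge almost surely, while the forward
  ones in general converge in distribution only.
\<close>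
lemma law_forward_eq_backward:
  "distr (S \<Otimes>\<^sub>M \<mu>\<^sub>0) borel (\<lambda>q. forward (fst q) n (snd q))
     = distr (S \<Otimes>\<^sub>M \<mu>\<^sub>0) borel (\<lambda>q. backward (fst q) n (snd q))"
  by (rule distr_borel_eqI)
     (simp_all add: nn_integral_init_backward nn_integral_init_forward
       borel_measurable_forward borel_measurable_backward)

lemma weak_conv_backward:
  "weak_conv_laws (\<lambda>n. distr (S \<Otimes>\<^sub>M \<mu>\<^sub>0) borel (\<lambda>q. backward (fst q) n (snd q))) (distr S borel perpetuity)"
  unfolding weak_conv_laws_def
proof (intro allI impI, elim conjE)
  fix f :: "real^'n^'n \<Rightarrow> real" assume cont: "continuous_on UNIV f" and "bounded (range f)"
  then obtain K where K: "\<And>x. norm (f x) \<le> K" by (auto simp: bounded_iff)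
  note [measurable] = borel_measurable_continuous_onI[OF cont] borel_measurable_backward
  have [measurable]: "perpetuity \<in> borel_measurable S"
    by (rule borel_measurable_perpetuity) simp
  have fst_law: "distr (S \<Otimes>\<^sub>M \<mu>\<^sub>0) S fst = S" by (rule init.distr_pair_fst)
  have "AE q in S \<Otimes>\<^sub>M \<mu>\<^sub>0. \<forall>x. (\<lambda>n. backward (fst q) n x) \<longlonglongrightarrow> perpetuity (fst q)"
    using AE_backward_converges
    by (intro AE_distrD[of fst "S \<Otimes>\<^sub>M \<mu>\<^sub>0" S]) (simp_all only: fst_law measurable_fst AE_conj_iff)
  then have "AE q in S \<Otimes>\<^sub>M \<mu>\<^sub>0. (\<lambda>n. f (backward (fst q) n (snd q))) \<longlonglongrightarrow> f (perpetuity (fst q))"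
    by eventually_elim (auto intro: continuous_on_tendsto_compose[OF cont])
  then have "(\<lambda>n. \<integral>q. f (backward (fst q) n (snd q)) \<partial>(S \<Otimes>\<^sub>M \<mu>\<^sub>0)) \<longlonglongrightarrow> (\<integral>q. f (perpetuity (fst q)) \<partial>(S \<Otimes>\<^sub>M \<mu>\<^sub>0))"
    by (intro integral_dominated_convergence[where w="\<lambda>_. K"]) (simp_all add: K[simplified])
  also have "(\<integral>q. f (perpetuity (fst q)) \<partial>(S \<Otimes>\<^sub>M \<mu>\<^sub>0)) = (\<integral>\<omega>. f (perpetuity \<omega>) \<partial>S)"
    using integral_distr[of fst "S \<Otimes>\<^sub>M \<mu>\<^sub>0" S "\<lambda>\<omega>. f (perpetuity \<omega>)"] by (simp add: fst_law)
  finally show "(\<lambda>n. \<integral>x. f x \<partial>distr (S \<Otimes>\<^sub>M \<mu>\<^sub>0) borel (\<lambda>q. backward (fst q) n (snd q)))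
      \<longlonglongrightarrow> (\<integral>x. f x \<partial>distr S borel perpetuity)"
    by (simp add: integral_distr)
qed

lemma weak_conv_forward:
  "weak_conv_laws (\<lambda>n. distr (S \<Otimes>\<^sub>M \<mu>\<^sub>0) borel (\<lambda>q. forward (fst q) n (snd q))) (distr S borel perpetuity)"
  unfolding law_forward_eq_backward by (rule weak_conv_backward)

lemma measurable_affine_image:
  "(\<lambda>q. affine_step (fst q) (snd q)) \<in> borel_measurable (\<nu> \<Otimes>\<^sub>M \<mu>\<^sub>0)"
proof (rule borel_measurable_affine_step)
  show "fst \<in> borel_measurable (\<nu> \<Otimes>\<^sub>M \<mu>\<^sub>0)"
    using measurable_fst[of \<nu> \<mu>\<^sub>0] by (simp cong: measurable_cong_sets add: sets_law)
  show "snd \<in> borel_measurable (\<nu> \<Otimes>\<^sub>M \<mu>\<^sub>0)"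
    using measurable_snd[of \<nu> \<mu>\<^sub>0] by (simp cong: measurable_cong_sets add: sets_init)
qed

lemma nn_integral_affine_image:
  assumes [measurable]: "f \<in> borel_measurable borel"
  shows "(\<integral>\<^sup>+q. f (affine_step (fst q) (snd q)) \<partial>(\<nu> \<Otimes>\<^sub>M \<mu>\<^sub>0)) = (\<integral>\<^sup>+x. transition f x \<partial>\<mu>\<^sub>0)"
proof -
  interpret nu_init: pair_prob_space \<nu> \<mu>\<^sub>0 ..
  note [measurable] = measurable_affine_image
  show ?thesis unfolding transition_def
    by (subst nu_init.nn_integral_snd[symmetric]) simp_all
qed

lemma solution_law_iff_transition_invariant:
  "solution_law \<nu> \<mu>\<^sub>0 \<longleftrightarrow>
     (\<forall>f\<in>borel_measurable borel. (\<integral>\<^sup>+x. transition f x \<partial>\<mu>\<^sub>0) = (\<integral>\<^sup>+x. f x \<partial>\<mu>\<^sub>0))"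
proof -
  have step: "(\<lambda>((a, b), x). a ** x ** transpose a + b) = (\<lambda>q. affine_step (fst q) (snd q))"
    by (auto simp: affine_step_def)
  note [measurable] = measurable_affine_image
  have id: "distr \<mu>\<^sub>0 borel (\<lambda>x. x) = \<mu>\<^sub>0"
    by (rule distr_id2) (simp add: sets_init)
  have [measurable]: "(\<lambda>x. x) \<in> borel_measurable \<mu>\<^sub>0" by (simp add: measurable_ident_sets sets_init)
  let ?D = "distr (\<nu> \<Otimes>\<^sub>M \<mu>\<^sub>0) borel (\<lambda>q. affine_step (fst q) (snd q))"
  have "\<mu>\<^sub>0 = ?D \<longleftrightarrow> (\<forall>f\<in>borel_measurable borel. (\<integral>\<^sup>+x. transition f x \<partial>\<mu>\<^sub>0) = (\<integral>\<^sup>+x. f x \<partial>\<mu>\<^sub>0))"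
  proof
    assume eq: "\<mu>\<^sub>0 = ?D"
    show "\<forall>f\<in>borel_measurable borel. (\<integral>\<^sup>+x. transition f x \<partial>\<mu>\<^sub>0) = (\<integral>\<^sup>+x. f x \<partial>\<mu>\<^sub>0)"
    proof
      fix f :: "real^'n^'n \<Rightarrow> ennreal" assume f [measurable]: "f \<in> borel_measurable borel"
      have "(\<integral>\<^sup>+x. f x \<partial>\<mu>\<^sub>0) = (\<integral>\<^sup>+x. f x \<partial>?D)" using eq by simp
      also have "\<dots> = (\<integral>\<^sup>+x. transition f x \<partial>\<mu>\<^sub>0)"
        by (simp add: nn_integral_distr nn_integral_affine_image)
      finally show "(\<integral>\<^sup>+x. transition f x \<partial>\<mu>\<^sub>0) = (\<integral>\<^sup>+x. f x \<partial>\<mu>\<^sub>0)" by simp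
    qed
  next
    assume "\<forall>f\<in>borel_measurable borel. (\<integral>\<^sup>+x. transition f x \<partial>\<mu>\<^sub>0) = (\<integral>\<^sup>+x. f x \<partial>\<mu>\<^sub>0)"
    then have "distr \<mu>\<^sub>0 borel (\<lambda>x. x) = ?D"
      by (intro distr_borel_eqI) (simp_all add: nn_integral_affine_image)
    then show "\<mu>\<^sub>0 = ?D" by (simp add: id)
  qed
  then show ?thesis
    using prob_init sets_init by (simp add: solution_law_def step)
qed

lemma law_backward_of_solution:
  assumes "solution_law \<nu> \<mu>\<^sub>0"
  shows "distr (S \<Otimes>\<^sub>M \<mu>\<^sub>0) borel (\<lambda>q. backward (fst q) n (snd q)) = \<mu>\<^sub>0"
proof -
  have inv: "(\<integral>\<^sup>+x. (transition ^^ n) f x \<partial>\<mu>\<^sub>0) = (\<integral>\<^sup>+x. f x \<partial>\<mu>\<^sub>0)"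
    if "f \<in> borel_measurable borel" for f
    using assms unfolding solution_law_iff_transition_invariant
    by (induction n) (simp_all add: measurable_transition_funpow that)
  have "distr (S \<Otimes>\<^sub>M \<mu>\<^sub>0) borel (\<lambda>q. backward (fst q) n (snd q)) = distr \<mu>\<^sub>0 borel (\<lambda>x. x)"
    by (rule distr_borel_eqI)
       (simp_all add: borel_measurable_backward nn_integral_init_backward inv
         measurable_ident_sets sets_init)
  then show ?thesis by (simp add: distr_id2 sets_init)
qed

end

lemma measurable_perpetuity [measurable]: "perpetuity \<in> borel_measurable S"
  by (rule borel_measurable_perpetuity) simp

text \<open>
  For almost every \<open>\<omega>\<close> the series of \<open>case_nat p \<omega>\<close> is \<open>affine_step p\<close> applied to the series of
  \<open>\<omega>\<close>.
\<close>
lemma solution_law_perpetuity: "solution_law \<nu> (distr S borel perpetuity)"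
proof (rule solution_law_iff_transition_invariant[THEN iffD2])
  show "prob_space (distr S borel perpetuity)" by (rule P.prob_space_distr) simp
  show "\<forall>f\<in>borel_measurable borel. (\<integral>\<^sup>+x. transition f x \<partial>distr S borel perpetuity)
      = (\<integral>\<^sup>+x. f x \<partial>distr S borel perpetuity)"
  proof
    fix f :: "real^'n^'n \<Rightarrow> ennreal" assume [measurable]: "f \<in> borel_measurable borel"
    have "(\<integral>\<^sup>+\<omega>. f (perpetuity \<omega>) \<partial>S) = (\<integral>\<^sup>+p. \<integral>\<^sup>+\<omega>. f (perpetuity (case_nat p \<omega>)) \<partial>S \<partial>\<nu>)"
      by (rule nn_integral_first_step) simp
    also have "\<dots> = (\<integral>\<^sup>+p. \<integral>\<^sup>+\<omega>. f (affine_step p (perpetuity \<omega>)) \<partial>S \<partial>\<nu>)"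
    proof (rule nn_integral_cong, rule nn_integral_cong_AE)
      fix p
      from AE_backward_converges
      show "AE \<omega> in S. f (perpetuity (case_nat p \<omega>)) = f (affine_step p (perpetuity \<omega>))"
        by eventually_elim (simp add: perpetuity_unfold)
    qed
    also have "\<dots> = (\<integral>\<^sup>+\<omega>. transition f (perpetuity \<omega>) \<partial>S)"
      unfolding transition_def by (rule nuS.Fubini'[symmetric]) simp
    finally show "(\<integral>\<^sup>+x. transition f x \<partial>distr S borel perpetuity)
      = (\<integral>\<^sup>+x. f x \<partial>distr S borel perpetuity)"
      by (simp add: nn_integral_distr)
  qed
qed simp

text \<open>
  Started in a solution, the iteration has constant law, and this law converges weakly to that of
  the series.
\<close>
lemma solution_law_unique:
  assumes sol: "solution_law \<nu> \<mu>"
  shows "\<mu> = distr S borel perpetuity"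
proof (rule weak_conv_laws_unique)
  show \<mu>: "prob_space \<mu>" "sets \<mu> = sets borel" using sol by (simp_all add: solution_law_def)
  show "prob_space (distr S borel perpetuity)" by (rule P.prob_space_distr) simp
  show "weak_conv_laws (\<lambda>_. \<mu>) (distr S borel perpetuity)"
    using weak_conv_backward[OF \<mu>] by (simp add: law_backward_of_solution[OF \<mu> sol])
qed simp

end

section \<open>Arbitrary probability spaces\<close>

lemma sequence_spaceI: "prob_space \<nu> \<Longrightarrow> sequence_space \<nu>"
  by (simp add: sequence_space_def product_prob_space_def product_sigma_finite_def
      product_prob_space_axioms_def prob_space_imp_sigma_finite)

text \<open>
  The positive part of the logarithm of a block is at most the sum of those of its factors, hence
  integrable, so that the truncation lemma applies.
\<close>
lemma contractive_recursion_exists: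
  fixes \<nu> :: "((real^'n^'n) \<times> (real^'n^'n)) measure"
  assumes "prob_space \<nu>" and sets [measurable_cong]: "sets \<nu> = sets borel"
    and log_A: "integrable \<nu> (\<lambda>p. log_plus ((opnorm (fst p))\<^sup>2))"
    and log_B: "integrable \<nu> (\<lambda>p. log_plus ((opnorm (snd p))\<^sup>2))"
    and n: "0 < n"
    and neg: "ext_expectation (PiM UNIV (\<lambda>_::nat. \<nu>))
      (\<lambda>\<omega>. ext_log ((opnorm (prefix_prod (\<lambda>i. fst (\<omega> i)) n))\<^sup>2)) < 0"
  obtains c where "contractive_recursion \<nu> n c"
proof -
  interpret sequence_space \<nu> by (rule sequence_spaceI) fact
  let ?q = "\<lambda>\<omega>::nat \<Rightarrow> (real^'n^'n) \<times> (real^'n^'n). (opnorm (prefix_prod (\<lambda>i. fst (\<omega> i)) n))\<^sup>2"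
  let ?V = "\<lambda>p. log_plus ((opnorm (fst p))\<^sup>2)"
  have [measurable]: "(\<lambda>\<omega>. \<omega> i) \<in> borel_measurable S" for i
    using measurable_component_singleton[of i UNIV "\<lambda>_. \<nu>"] by (simp cong: measurable_cong_sets add: sets)
  have le: "log_plus (?q \<omega>) \<le> (\<Sum>i<n. ?V (\<omega> i))" for \<omega>
    by (subst log_plus_le_iff)
       (auto intro!: sq_opnorm_prefix_prod_le sum_nonneg le_exp_log_plus simp: log_plus_nonneg)
  have V_fin: "(\<integral>\<^sup>+\<omega>. ennreal (?V (\<omega> i)) \<partial>S) < \<infinity>" for i
  proof -
    have "integrable (distr S \<nu> (\<lambda>\<omega>. \<omega> i)) ?V" using log_A by (simp add: distr_component)
    then have "integrable S (\<lambda>\<omega>. ?V (\<omega> i))" by (rule integrable_distr[rotated]) simp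
    then show ?thesis by (simp add: integrable_iff_bounded abs_of_nonneg log_plus_nonneg)
  qed
  have "(\<integral>\<^sup>+\<omega>. ennreal (log_plus (?q \<omega>)) \<partial>S) \<le> (\<integral>\<^sup>+\<omega>. (\<Sum>i<n. ennreal (?V (\<omega> i))) \<partial>S)"
    by (intro nn_integral_mono) (simp add: sum_ennreal log_plus_nonneg le ennreal_leI)
  also have "\<dots> = (\<Sum>i<n. \<integral>\<^sup>+\<omega>. ennreal (?V (\<omega> i)) \<partial>S)"
    by (rule nn_integral_sum) simp
  also have "\<dots> < \<infinity>"
    using V_fin by (simp add: ennreal_sum_less_top)
  finally have pos: "(\<integral>\<^sup>+\<omega>. ennreal (log_plus (?q \<omega>)) \<partial>S) < \<infinity>" .
  obtain c where "0 < c" "integrable S (\<lambda>\<omega>. ln (max c (?q \<omega>)))" "(\<integral>\<omega>. ln (max c (?q \<omega>)) \<partial>S) < 0"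
    by (rule truncated_log_integral_neg[OF P.prob_space_axioms _ _ pos neg]) auto
  then have "contractive_recursion \<nu> n c"
    using sets log_A log_B n
    by unfold_locales
  then show thesis by (rule that)
qed

text \<open>
  Sequences indexed from \<open>1\<close> are moved to the index set of \<open>sequence_space\<close>, where all laws are
  computed.
\<close>
lemma (in prob_space) distr_iid_sequence:
  assumes indep: "indep_vars (\<lambda>_. N) Z {1::nat..}"
    and law: "\<And>n. 1 \<le> n \<Longrightarrow> distr M N (Z n) = \<nu>"
  shows "distr M (PiM UNIV (\<lambda>_. \<nu>)) (\<lambda>\<omega> i. Z (Suc i) \<omega>) = PiM UNIV (\<lambda>_. \<nu>)"
proof -
  have Z: "Z n \<in> measurable M N" if "1 \<le> n" for n
    using indep that by (auto simp: indep_vars_def)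
  have \<nu>: "prob_space \<nu>" using law[of 1] prob_space_distr[OF Z[of 1]] by simp
  have sets: "sets \<nu> = sets N" using law[of 1] by (metis le_refl sets_distr)
  have "distr M (PiM {1..} (\<lambda>_. N)) (\<lambda>\<omega>. \<lambda>i\<in>{1..}. Z i \<omega>) = PiM {1..} (\<lambda>i. distr M N (Z i))"
    using indep_vars_iff_distr_eq_PiM'[where I="{1..}" and M'="\<lambda>_. N" and X=Z] indep Z by auto
  also have "\<dots> = PiM {1..} (\<lambda>_. \<nu>)" by (intro PiM_cong) (auto simp: law)
  finally have joint: "distr M (PiM {1..} (\<lambda>_. N)) (\<lambda>\<omega>. \<lambda>i\<in>{1..}. Z i \<omega>) = PiM {1..} (\<lambda>_. \<nu>)" .
  have shift: "(\<lambda>y. \<lambda>i\<in>UNIV. y (Suc i)) \<in> measurable (PiM {1..} (\<lambda>_. N)) (PiM UNIV (\<lambda>_. \<nu>))"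
    by (intro measurable_restrict) (simp add: measurable_cong_sets[OF refl sets])
  have "PiM UNIV (\<lambda>_. \<nu>) = distr (PiM {1..} (\<lambda>_. \<nu>)) (PiM UNIV (\<lambda>_. \<nu>)) (\<lambda>y. \<lambda>i\<in>UNIV. y (Suc i))"
    by (rule distr_PiM_reindex[symmetric]) (auto simp: \<nu>)
  also have "\<dots> = distr M (PiM UNIV (\<lambda>_. \<nu>)) ((\<lambda>y. \<lambda>i\<in>UNIV. y (Suc i)) \<circ> (\<lambda>\<omega>. \<lambda>i\<in>{1..}. Z i \<omega>))"
    unfolding joint[symmetric] by (rule distr_distr[OF shift]) (intro measurable_restrict Z, simp)
  also have "((\<lambda>y. \<lambda>i\<in>UNIV. y (Suc i)) \<circ> (\<lambda>\<omega>. \<lambda>i\<in>{1..}. Z i \<omega>)) = (\<lambda>\<omega> i. Z (Suc i) \<omega>)"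
    by (auto simp: fun_eq_iff)
  finally show ?thesis by simp
qed

text \<open>
  The map \<open>h\<close> is needed for the change of index set, under which independence has to be kept.
\<close>
lemma (in prob_space) distr_pair_of_indep_rvs:
  assumes indep: "indep_rvs M S X T Y" and h: "h \<in> measurable T R"
  shows "distr M (R \<Otimes>\<^sub>M S) (\<lambda>\<omega>. (h (Y \<omega>), X \<omega>)) = distr M R (\<lambda>\<omega>. h (Y \<omega>)) \<Otimes>\<^sub>M distr M S X"
proof -
  have X [measurable]: "X \<in> measurable M S" and Y: "Y \<in> measurable M T"
    and ind: "indep_set {X -` U \<inter> space M | U. U \<in> sets S} {Y -` V \<inter> space M | V. V \<in> sets T}"
    using indep by (simp_all add: indep_rvs_def)
  have hY [measurable]: "(\<lambda>\<omega>. h (Y \<omega>)) \<in> measurable M R"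
    using Y h by (rule measurable_compose)
  interpret D: prob_space "distr M R (\<lambda>\<omega>. h (Y \<omega>))" by (rule prob_space_distr) simp
  interpret E: prob_space "distr M S X" by (rule prob_space_distr) simp
  show ?thesis
  proof (rule pair_measure_eqI[symmetric])
    fix V U assume "V \<in> sets (distr M R (\<lambda>\<omega>. h (Y \<omega>)))" "U \<in> sets (distr M S X)"
    then have [measurable]: "V \<in> sets R" and U [measurable]: "U \<in> sets S" by simp_all
    let ?V = "(\<lambda>\<omega>. h (Y \<omega>)) -` V \<inter> space M" and ?U = "X -` U \<inter> space M"
    have "?V = Y -` (h -` V \<inter> space T) \<inter> space M"
    proof (rule set_eqI)
      show "\<omega> \<in> ?V \<longleftrightarrow> \<omega> \<in> Y -` (h -` V \<inter> space T) \<inter> space M" for \<omega>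
        using measurable_space[OF Y, of \<omega>] by blast
    qed
    then have V_mem: "?V \<in> {Y -` V \<inter> space M | V. V \<in> sets T}"
      by (intro CollectI exI[of _ "h -` V \<inter> space T"] conjI measurable_sets[OF h]) simp_all
    have U_mem: "?U \<in> {X -` U \<inter> space M | U. U \<in> sets S}" using U by blast
    have "prob (?U \<inter> ?V) = prob ?U * prob ?V" by (rule indep_setD[OF ind U_mem V_mem])
    moreover have "(\<lambda>\<omega>. (h (Y \<omega>), X \<omega>)) -` (V \<times> U) \<inter> space M = ?U \<inter> ?V" by auto
    ultimately show "emeasure (distr M R (\<lambda>\<omega>. h (Y \<omega>))) V * emeasure (distr M S X) U =
        emeasure (distr M (R \<Otimes>\<^sub>M S) (\<lambda>\<omega>. (h (Y \<omega>), X \<omega>))) (V \<times> U)"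
      by (simp add: emeasure_distr emeasure_eq_measure ennreal_mult mult.commute)
  qed (auto intro: D.sigma_finite_measure_axioms E.sigma_finite_measure_axioms)
qed

lemma left_prod_eq_prefix_prod: "left_prod a n = prefix_prod (\<lambda>i. a (Suc i)) n"
  by (induction n) simp_all

lemma right_prod_eq_transpose: "right_prod a n = transpose (left_prod a n)"
  by (induction n) (simp_all add: transpose_mat matrix_transpose_mul)

lemma series_term_eq_perpetuity_term:
  "series_term a b (Suc n) = perpetuity_term (\<lambda>i. (a (Suc i), b (Suc i))) n"
  by (simp add: series_term_def perpetuity_term_def right_prod_eq_transpose left_prod_eq_prefix_prod)

lemma ext_log_measurable [measurable]: "ext_log \<in> borel_measurable borel"
  unfolding ext_log_def by measurable

lemma ext_expectation_distr:
  assumes [measurable]: "T \<in> measurable M N" "f \<in> borel_measurable N"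
  shows "ext_expectation (distr M N T) f = ext_expectation M (\<lambda>\<omega>. f (T \<omega>))"
  unfolding ext_expectation_def by (simp add: nn_integral_distr)

lemma integrable_log_plus_distr:
  assumes g [measurable]: "g \<in> measurable M borel" and f [measurable]: "f \<in> borel_measurable borel"
    and fin: "(\<integral>\<^sup>+\<omega>. ennreal (log_plus (f (g \<omega>))) \<partial>M) < \<infinity>"
  shows "integrable (distr M borel g) (\<lambda>p. log_plus (f p))"
  using fin by (intro integrableI_nonneg) (auto simp: log_plus_nonneg nn_integral_distr)

theorem theorem3p1:
  fixes P :: "'b measure" and A B :: "'b \<Rightarrow> real^'n^'n"
    and M :: "'a measure" and As Bs :: "nat \<Rightarrow> 'a \<Rightarrow> real^'n^'n"
  assumes "prob_space P" and "A \<in> borel_measurable P" and "B \<in> borel_measurable P"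
    and "prob_space M"
    and indep: "prob_space.indep_vars M (\<lambda>_. borel) (\<lambda>n \<omega>. (As n \<omega>, Bs n \<omega>)) {1..}"
    and copies: "\<And>n. n \<ge> 1 \<Longrightarrow>
      distr M borel (\<lambda>\<omega>. (As n \<omega>, Bs n \<omega>)) = distr P borel (\<lambda>\<omega>. (A \<omega>, B \<omega>))"
    and logA: "(\<integral>\<^sup>+\<omega>. ennreal (log_plus (lambda_max (A \<omega> ** transpose (A \<omega>)))) \<partial>P) < \<infinity>"
    and logB: "(\<integral>\<^sup>+\<omega>. ennreal (log_plus (lambda_max (B \<omega> ** transpose (B \<omega>)))) \<partial>P) < \<infinity>"
    and gamma: "lyapunov_gamma M As < 0"
  shows "\<exists>\<mu>. solution_law (distr P borel (\<lambda>\<omega>. (A \<omega>, B \<omega>))) \<mu>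
    \<and> (\<forall>\<mu>'. solution_law (distr P borel (\<lambda>\<omega>. (A \<omega>, B \<omega>))) \<mu>' \<longrightarrow> \<mu>' = \<mu>)
    \<and> (AE \<omega> in M. summable (\<lambda>n. series_term (\<lambda>k. As k \<omega>) (\<lambda>k. Bs k \<omega>) (Suc n)))
    \<and> distr M borel (\<lambda>\<omega>. \<Sum>n. series_term (\<lambda>k. As k \<omega>) (\<lambda>k. Bs k \<omega>) (Suc n)) = \<mu>
    \<and> (\<forall>X :: nat \<Rightarrow> 'a \<Rightarrow> real^'n^'n.
         indep_rvs M borel (X 0) (PiM {1..} (\<lambda>_. borel))
           (\<lambda>\<omega>. \<lambda>n\<in>{1..}. (As n \<omega>, Bs n \<omega>))
         \<and> (\<forall>n\<ge>1. \<forall>\<omega>\<in>space M. X n \<omega> = As n \<omega> ** X (n - 1) \<omega> ** transpose (As n \<omega>) + Bs n \<omega>)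
         \<longrightarrow> weak_conv_laws (\<lambda>n. distr M borel (X n)) \<mu>)"
proof -
  interpret single: prob_space P by fact
  interpret iid: prob_space M by fact
  note [measurable] = \<open>A \<in> borel_measurable P\<close> \<open>B \<in> borel_measurable P\<close>
  define \<nu> where "\<nu> = distr P borel (\<lambda>\<omega>. (A \<omega>, B \<omega>))"
  define path where "path = (\<lambda>\<omega> i. (As (Suc i) \<omega>, Bs (Suc i) \<omega>))"
  let ?S = "PiM UNIV (\<lambda>_::nat. \<nu>)"
  have AB [measurable]: "(\<lambda>\<omega>. (A \<omega>, B \<omega>)) \<in> borel_measurable P" by simp
  have \<nu>: "prob_space \<nu>" unfolding \<nu>_def by (rule single.prob_space_distr) simp
  have sets_\<nu> [measurable_cong]: "sets \<nu> = sets borel" by (simp add: \<nu>_def)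
  have path_law: "distr M ?S path = ?S"
    unfolding path_def using iid.distr_iid_sequence[OF indep copies] by (simp add: \<nu>_def)
  have path_component: "(\<lambda>\<omega>. path \<omega> i) \<in> borel_measurable M" for i
    using indep by (auto simp: iid.indep_vars_def path_def)
  have path [measurable]: "path \<in> measurable M ?S"
    using path_component by (intro measurable_PiM_single')
      (auto simp: space_PiM measurable_cong_sets[OF refl sets_\<nu>] sets_eq_imp_space_eq[OF sets_\<nu>])
  have coordinate [measurable]: "(\<lambda>\<omega>. \<omega> i) \<in> borel_measurable ?S" for i
    using measurable_component_singleton[of i UNIV "\<lambda>_. \<nu>"] by (simp cong: measurable_cong_sets add: sets_\<nu>)

  \<comment> \<open>a block length at which the infimum defining \<open>\<gamma>\<close> is already negative\<close>
  obtain n where n: "1 \<le> n" and "ereal (1 / real n) * ext_expectation M (\<lambda>\<omega>. ext_log (lambda_max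
      (left_prod (\<lambda>k. As k \<omega>) n ** right_prod (\<lambda>k. As k \<omega>) n))) < 0"
    using gamma by (auto simp: lyapunov_gamma_def INF_less_iff)
  then have "ext_expectation M (\<lambda>\<omega>. ext_log (lambda_max
      (left_prod (\<lambda>k. As k \<omega>) n ** right_prod (\<lambda>k. As k \<omega>) n))) < 0"
    by (rule_tac ccontr) (auto simp: not_less ereal_zero_le_0_iff simp flip: not_le)
  then have "ext_expectation M (\<lambda>\<omega>. ext_log ((opnorm (prefix_prod (\<lambda>i. fst (path \<omega> i)) n))\<^sup>2)) < 0"
    by (simp add: right_prod_eq_transpose lambda_max_gram left_prod_eq_prefix_prod path_def)
  then have "ext_expectation (distr M ?S path) (\<lambda>\<omega>. ext_log ((opnorm (prefix_prod (\<lambda>i. fst (\<omega> i)) n))\<^sup>2)) < 0"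
    by (subst ext_expectation_distr) simp_all
  then have neg: "ext_expectation ?S (\<lambda>\<omega>. ext_log ((opnorm (prefix_prod (\<lambda>i. fst (\<omega> i)) n))\<^sup>2)) < 0"
    by (simp only: path_law)
  have log_A: "integrable \<nu> (\<lambda>p. log_plus ((opnorm (fst p))\<^sup>2))"
    unfolding \<nu>_def using logA by (intro integrable_log_plus_distr) (simp_all add: lambda_max_gram)
  have log_B: "integrable \<nu> (\<lambda>p. log_plus ((opnorm (snd p))\<^sup>2))"
    unfolding \<nu>_def using logB by (intro integrable_log_plus_distr) (simp_all add: lambda_max_gram)
  obtain c where "contractive_recursion \<nu> n c"
    using contractive_recursion_exists[OF \<nu> sets_\<nu> log_A log_B _ neg] n by auto
  then interpret contractive_recursion \<nu> n c .

  let ?\<mu> = "distr S borel perpetuity"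
  have series: "(\<lambda>n. series_term (\<lambda>k. As k \<omega>) (\<lambda>k. Bs k \<omega>) (Suc n)) = perpetuity_term (path \<omega>)" for \<omega>
    by (simp add: series_term_eq_perpetuity_term path_def)
  have "AE \<omega> in distr M S path. summable (perpetuity_term \<omega>)"
    unfolding path_law using AE_backward_converges by eventually_elim simp
  then have summable: "AE \<omega> in M. summable (perpetuity_term (path \<omega>))"
    by (rule AE_distrD[OF path])
  have "distr (distr M S path) borel perpetuity = distr M borel (perpetuity \<circ> path)"
    by (rule distr_distr) simp_all
  then have series_law: "distr M borel (\<lambda>\<omega>. perpetuity (path \<omega>)) = ?\<mu>"
    by (simp add: path_law comp_def)
  have conv: "weak_conv_laws (\<lambda>n. distr M borel (X n)) ?\<mu>"
    if ind: "indep_rvs M borel (X 0) (PiM {1..} (\<lambda>_. borel)) (\<lambda>\<omega>. \<lambda>n\<in>{1..}. (As n \<omega>, Bs n \<omega>))"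
      and rec: "\<forall>n\<ge>1. \<forall>\<omega>\<in>space M. X n \<omega> = As n \<omega> ** X (n - 1) \<omega> ** transpose (As n \<omega>) + Bs n \<omega>"
    for X :: "nat \<Rightarrow> 'a \<Rightarrow> real^'n^'n"
  proof -
    have X0 [measurable]: "X 0 \<in> borel_measurable M" using ind unfolding indep_rvs_def by blast
    let ?\<mu>\<^sub>0 = "distr M borel (X 0)"
    have \<mu>\<^sub>0: "prob_space ?\<mu>\<^sub>0" by (rule iid.prob_space_distr) simp
    have shift: "(\<lambda>y i. y (Suc i)) \<in> measurable (PiM {1..} (\<lambda>_. borel)) S"
      by (rule measurable_PiM_single')
         (auto simp: space_PiM measurable_cong_sets[OF refl sets_\<nu>] sets_eq_imp_space_eq[OF sets_\<nu>])
    have joint: "distr M (S \<Otimes>\<^sub>M borel) (\<lambda>\<omega>. (path \<omega>, X 0 \<omega>)) = S \<Otimes>\<^sub>M ?\<mu>\<^sub>0"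
      using iid.distr_pair_of_indep_rvs[OF ind shift] path_law by (simp add: path_def)
    have X_eq: "X k \<omega> = forward (path \<omega>) k (X 0 \<omega>)" if "\<omega> \<in> space M" for k \<omega>
    proof (induction k)
      case (Suc k)
      have "X (Suc k) \<omega> = affine_step (path \<omega> k) (X k \<omega>)"
        using rec[rule_format, of "Suc k" \<omega>] that by (simp add: affine_step_def path_def)
      then show ?case by (simp add: Suc.IH)
    qed simp
    have law: "distr M borel (X k) = distr (S \<Otimes>\<^sub>M ?\<mu>\<^sub>0) borel (\<lambda>q. forward (fst q) k (snd q))" for k
    proof -
      have "(\<lambda>q. fst q i) \<in> borel_measurable (S \<Otimes>\<^sub>M (borel :: (real^'n^'n) measure))" for i
        using measurable_compose[OF measurable_fst coordinate] by simp
      then have "distr (distr M (S \<Otimes>\<^sub>M borel) (\<lambda>\<omega>. (path \<omega>, X 0 \<omega>))) borel (\<lambda>q. forward (fst q) k (snd q))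
          = distr M borel ((\<lambda>q. forward (fst q) k (snd q)) \<circ> (\<lambda>\<omega>. (path \<omega>, X 0 \<omega>)))"
        by (intro distr_distr borel_measurable_forward) simp_all
      also have "\<dots> = distr M borel (X k)"
        by (rule distr_cong) (simp_all flip: X_eq)
      finally show ?thesis by (simp add: joint)
    qed
    show ?thesis
      using weak_conv_forward[OF \<mu>\<^sub>0 sets_distr] unfolding law[symmetric] .
  qed
  show ?thesis
    unfolding series \<nu>_def[symmetric] perpetuity_def[symmetric]
  proof (intro exI[of _ ?\<mu>] conjI allI impI)
    show "solution_law \<nu> ?\<mu>" by (rule solution_law_perpetuity)
    show "\<mu>' = ?\<mu>" if "solution_law \<nu> \<mu>'" for \<mu>'
      using that by (rule solution_law_unique)
    show "AE \<omega> in M. summable (perpetuity_term (path \<omega>))" by (rule summable)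
    show "distr M borel (\<lambda>\<omega>. perpetuity (path \<omega>)) = ?\<mu>" by (rule series_law)
    fix X :: "nat \<Rightarrow> 'a \<Rightarrow> real^'n^'n"
    assume "indep_rvs M borel (X 0) (PiM {1..} (\<lambda>_. borel)) (\<lambda>\<omega>. \<lambda>n\<in>{1..}. (As n \<omega>, Bs n \<omega>))
      \<and> (\<forall>n\<ge>1. \<forall>\<omega>\<in>space M. X n \<omega> = As n \<omega> ** X (n - 1) \<omega> ** transpose (As n \<omega>) + Bs n \<omega>)"
    then show "weak_conv_laws (\<lambda>n. distr M borel (X n)) ?\<mu>" by (intro conv) blast+
  qed
qed

end
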